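(* Consider the nonconvex separable problem described in the context, with $\mathrm{dom}(f_i)$ convex and $\rho(f_i)$ the nonconvexity of $f_i$, for all $i=1,\dots,N$. Assume that the two-stage algorithm with Carathéodory step described in the context is applied with input $\lambda_0=0_m$ and $x_i^0\in\mathrm{dom}(f_i)$ such that $f_i(x_i^0)=f_i^{**}(x_i^0)$ for all $i$, and stepsize $\alpha_t=\frac{\Lambda}{\tilde G\sqrt T}$ (with $\Lambda>0$). Let $\epsilon>0$. By setting $T=K$, the solution $\bar x$ defined by $\bar x_i=\sum_{l\in Q_i}\tilde\omega_i^lx_i^l$ if $i\in S$ and $\bar x_i=x_i^{l_i}$ if $i\notin S$ satisfies $$\mathbb{E}\Big[\frac1N\sum_{i=1}^Nf_i(\bar x_i)-d^*\Big]\le\frac{m+1}N\max_i\rho(f_i)+\epsilon\quad\text{and}\quad\mathbb{E}\Big\|\frac1N\sum_{i=1}^NA_i\bar x_i-b\Big\|_+\le\epsilon,$$ after at most $O\big(\frac1{\epsilon^2}+\frac N{\epsilon^{2/3}}\big)$ oracle calls. An additional computation of the Carathéodory decomposition is also required.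
   Context: Problem. For $i=1,\dots,N$, $f_i:\mathbb{R}^{d_i}\to\mathbb{R}\cup\{+\infty\}$ is closed, proper, has an affine minorant, and has compact domain $\mathrm{dom}(f_i)$ (no convexity of $f_i$ is assumed); $A_i\in\mathbb{R}^{m\times d_i}$, $b\in\mathbb{R}^m$. The nonconvex problem is to minimize $\frac1N\sum_if_i(x_i)$ subject to $\frac1N\sum_iA_ix_i\le b$, $x_i\in\mathrm{dom}(f_i)$. Its bidual replaces $f_i$ by the biconjugate $f_i^{**}$ and $\mathrm{dom}(f_i)$ by $X_i:=\mathrm{conv}(\mathrm{dom}(f_i))$. The dual function is $d(\lambda)=-\lambda^\top b+\frac1N\sum_i\inf_{x_i\in X_i}\{f_i^{**}(x_i)+\lambda^\top A_ix_i\}$. Standing assumption: there is $\lambda^*\in\arg\max_{\lambda\in\mathbb{R}^m_+}d(\lambda)$, and $d^*:=d(\lambda^* )$ equals the optimal value of the bidual (strong duality). Nonconvexity: $\rho(f_i)=\sup\{f_i(\sum_{j=1}^p\alpha_jx^j)-\sum_{j=1}^p\alpha_jf_i(x^j):p\in\mathbb{N},\,x^j\in\mathrm{dom}(f_i),\,\alpha_j\ge0,\,\sum_j\alpha_j=1\}$. Notation. $\|\cdot\|$ is the Euclidean norm, $\|x\|_+=\sqrt{\sum_j\max(x_j,0)^2}$, $\Pi_+(x)_j=\max(x_j,0)$; $\tilde G=\sup_{i,\,x_i\in X_i}\|A_ix_i-b\|$, $H=\sup_{i,\,x_i\in X_i}|f_i^{**}(x_i)|$, $C_i=\{(f_i^{**}(x_i),A_ix_i):x_i\in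 X_i\}$, $D^2=\frac1N\sum_i\mathrm{diam}(\mathrm{conv}(C_i))^2$. The $O(\cdot)$ notation keeps only $N$ and $\epsilon$ and hides the other quantities ($\tilde G,H,D,\Lambda,\|\lambda^*\|$). Oracle. For $\gamma\ge0,\lambda\in\mathbb{R}^m$, an oracle call for index $i$ returns $x_i^*((\gamma,\lambda))\in\arg\min_{x_i\in X_i}\{\gamma f_i^{**}(x_i)+\lambda^\top A_ix_i\}$, assumed to be a point of $\mathrm{dom}(f_i)$ at which $f_i=f_i^{**}$. Write $x_i^*(\lambda)=x_i^*((1,\lambda))$. Stage 1 (stochastic dual subgradient, $T$ iterations, start $\lambda_0$). For $t=0,\dots,T-2$: sample $i_t$ uniformly at random in $\{1,\dots,N\}$, set $g_t=A_{i_t}x^*_{i_t}(\lambda_t)-b$, $\lambda_{t+1}=\Pi_+(\lambda_t+\alpha_tg_t)$. At $t=T-1$, a full step: compute $x_i^*(\lambda_{T-1})$ for all $i$, $g_{T-1}=\frac1N\sum_iA_ix_i^*(\lambda_{T-1})-b$, $\lambda_T=\Pi_+(\lambda_{T-1}+\alpha_{T-1}g_{T-1})$. Output $\bar\lambda_T=\frac1T\sum_{t=0}^{T-1}\lambda_t$. Stage 2 (block-coordinate Frank-Wolfe, $K$ iterations, input $d(\bar\lambda_T)$ and $x_i^0$, $i=1,\dots,N$). Set $\beta_i^0=\frac1Nf_i^{**}(x_i^0)$ $(=\frac1Nf_i(x_i^0))$, $z_i^0=\frac1NA_ix_i^0$. For $k=0,\dots,K-1$: with $\beta^k=\sum_i\beta_i^k$,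 $z^k=\sum_iz_i^k$, set $\gamma^k=\max(\beta^k-d(\bar\lambda_T),0)$, $g^k=\Pi_+(z^k-b)$; sample $i_k$ uniformly at random in $\{1,\dots,N\}$; $x_{i_k}^{k+1}=x_{i_k}^*((\gamma^k,g^k))$; for $i=i_k$ set $(\beta_i^{k+1},z_i^{k+1})=(1-\rho_k)(\beta_i^k,z_i^k)+\frac{\rho_k}N(f_i(x_i^{k+1}),A_ix_i^{k+1})$ with $\rho_k=\frac{2N}{k+2N}$; other blocks unchanged. The output can be written $(\beta^K,z^K)=\sum_{i=1}^N\sum_{l\in Q_i}\omega_i^l\frac1N(f_i(x_i^l),A_ix_i^l)$ with $Q_i$ a finite index set, $\omega_i^l\ge0$, $\sum_{l\in Q_i}\omega_i^l=1$, and $x_i^l\in\mathrm{dom}(f_i)$ (the initial point and the oracle outputs for index $i$). Carathéodory step. By the conic Carathéodory theorem in $\mathbb{R}^{1+m+N}$ applied to the vectors $(\frac1Nf_i(x_i^l),\frac1NA_ix_i^l,e_i)$ ($e_i$ the canonical basis of $\mathbb{R}^N$), one computes new weights $\tilde\omega_i^l\ge0$ with $\sum_{l\in Q_i}\tilde\omega_i^l=1$ for all $i$ and at most $1+m+N$ nonzero weights, such that $$\begin{pmatrix}\beta^K \\ z^K\end{pmatrix}=\sum_{i\in S}\sum_{l\in Q_i}\tilde\omega_i^l\frac1N\begin{pmatrix}f_i(x_i^l) \\ A_ix_i^l\end{pmatrix}+\sum_{i\notin S}\frac1N\begin{pmatrix}f_i(x_i^{l_i}) \\ A_ix_i^{l_i}\end{pmatrix},$$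 with $S\subset\{1,\dots,N\}$, $|S|\le m+1$, $l_i\in Q_i$ for $i\notin S$. Counting of oracle calls: one call per iteration of stage 1, except its last one which uses $N$ calls, and one per iteration of stage 2. $\mathbb{E}$ is the expectation over all randomness of the algorithm. *)

theory Defs
  imports "HOL-Analysis.Analysis" "HOL-Probability.Probability"
begin

section \<open>Euclidean spaces of varying dimension\<close>

text \<open>
  The dimensions \<open>m\<close> and \<open>d\<^sub>i\<close> vary with the problem while the constant of the complexity bound
  does not, so they cannot be types.  All spaces \<open>\<real>\<^sup>n\<close> are realised as the subspaces
  \<open>Rn n\<close> of one inner product space, the finitely supported real sequences.  On \<open>Rn n\<close> its inner product, norm and topology are the Euclidean ones; coordinates
  are numbered from \<open>0\<close>.
\<close>

typedef fvec = "{v :: nat \<Rightarrow> real. finite {j. v j \<noteq> 0}}"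
  morphisms coord Abs_fvec
  by (rule exI [of _ "\<lambda>_. 0"]) simp

setup_lifting type_definition_fvec

lemma finite_coord [simp]: "finite {j. coord x j \<noteq> 0}"
  using coord [of x] by simp

lemma fvec_eqI: "(\<And>j. coord x j = coord y j) \<Longrightarrow> x = y"
  by (metis coord_inject ext)

instantiation fvec :: real_vector
begin

lift_definition zero_fvec :: fvec is "\<lambda>_. 0" by simp

lift_definition plus_fvec :: "fvec \<Rightarrow> fvec \<Rightarrow> fvec" is "\<lambda>u v j. u j + v j"
proof -
  fix u v :: "nat \<Rightarrow> real"
  assume "finite {j. u j \<noteq> 0}" "finite {j. v j \<noteq> 0}"
  then show "finite {j. u j + v j \<noteq> 0}"
    by (rule_tac finite_subset [of _ "{j. u j \<noteq> 0} \<union> {j. v j \<noteq> 0}"]) auto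
qed

lift_definition uminus_fvec :: "fvec \<Rightarrow> fvec" is "\<lambda>u j. - u j" by simp

lift_definition minus_fvec :: "fvec \<Rightarrow> fvec \<Rightarrow> fvec" is "\<lambda>u v j. u j - v j"
proof -
  fix u v :: "nat \<Rightarrow> real"
  assume "finite {j. u j \<noteq> 0}" "finite {j. v j \<noteq> 0}"
  then show "finite {j. u j - v j \<noteq> 0}"
    by (rule_tac finite_subset [of _ "{j. u j \<noteq> 0} \<union> {j. v j \<noteq> 0}"]) auto
qed

lift_definition scaleR_fvec :: "real \<Rightarrow> fvec \<Rightarrow> fvec" is "\<lambda>c u j. c * u j"
  by (rule finite_subset) auto

instance
  by standard (transfer; simp add: algebra_simps fun_eq_iff)+

end

lemma coord_zero [simp]: "coord 0 j = 0"
  and coord_add [simp]: "coord (x + y) j = coord x j + coord y j"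
  and coord_uminus [simp]: "coord (- x) j = - coord x j"
  and coord_diff [simp]: "coord (x - y) j = coord x j - coord y j"
  and coord_scaleR [simp]: "coord (c *\<^sub>R x) j = c * coord x j"
  by (transfer, simp)+

lemma coord_sum [simp]: "coord (sum g I) j = (\<Sum>i\<in>I. coord (g i) j)"
  by (induction I rule: infinite_finite_induct) auto

instantiation fvec :: real_inner
begin

definition inner_fvec :: "fvec \<Rightarrow> fvec \<Rightarrow> real" where
  "inner_fvec x y = (\<Sum>j | coord x j \<noteq> 0. coord x j * coord y j)"

definition norm_fvec :: "fvec \<Rightarrow> real" where
  "norm_fvec x = sqrt (inner x x)"

definition dist_fvec :: "fvec \<Rightarrow> fvec \<Rightarrow> real" where
  "dist_fvec x y = norm (x - y)"

definition sgn_fvec :: "fvec \<Rightarrow> fvec" where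
  "sgn_fvec x = x /\<^sub>R norm x"

definition uniformity_fvec :: "(fvec \<times> fvec) filter" where
  "uniformity_fvec = (INF e\<in>{0<..}. principal {(x, y). dist x y < e})"

definition open_fvec :: "fvec set \<Rightarrow> bool" where
  "open_fvec U = (\<forall>x\<in>U. eventually (\<lambda>(x', y). x' = x \<longrightarrow> y \<in> U) uniformity)"

lemma inner_fvec_superset:
  assumes "finite J" "{j. coord x j \<noteq> 0} \<subseteq> J"
  shows "inner x y = (\<Sum>j\<in>J. coord x j * coord y j)"
  unfolding inner_fvec_def using assms by (intro sum.mono_neutral_left) auto

instance
proof
  fix x y z :: fvec and r :: real
  let ?s = "\<lambda>x. {j. coord x j \<noteq> 0}"
  define J where "J = ?s x \<union> ?s y \<union> ?s z"
  have J: "finite J" unfolding J_def by simp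
  have i: "inner u v = (\<Sum>j\<in>J. coord u j * coord v j)" if "?s u \<subseteq> J" for u v
    using inner_fvec_superset [OF J that] .
  have sub: "?s x \<subseteq> J" "?s y \<subseteq> J" "?s (x + y) \<subseteq> J" "?s (r *\<^sub>R x) \<subseteq> J"
    unfolding J_def by auto
  show "inner x y = inner y x"
    using i [OF sub(1)] i [OF sub(2)] by (simp add: mult.commute)
  show "inner (x + y) z = inner x z + inner y z"
    using i [OF sub(1)] i [OF sub(2)] i [OF sub(3)] by (simp add: algebra_simps sum.distrib)
  show "inner (r *\<^sub>R x) y = r * inner x y"
    using i [OF sub(1)] i [OF sub(4)] by (simp add: sum_distrib_left mult.assoc)
  show "0 \<le> inner x x"
    unfolding inner_fvec_def by (intro sum_nonneg) simp
  show "inner x x = 0 \<longleftrightarrow> x = 0"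
  proof
    assume "inner x x = 0"
    then have "coord x j * coord x j = 0" if "coord x j \<noteq> 0" for j
      unfolding inner_fvec_def using that by (subst (asm) sum_nonneg_eq_0_iff) auto
    then show "x = 0" by (intro fvec_eqI) auto
  qed (simp add: inner_fvec_def)
qed (simp_all add: norm_fvec_def dist_fvec_def sgn_fvec_def uniformity_fvec_def open_fvec_def)

end

definition Rn :: "nat \<Rightarrow> fvec set" where
  "Rn n = {x. \<forall>j\<ge>n. coord x j = 0}"

lemma inner_Rn: "x \<in> Rn n \<Longrightarrow> inner x y = (\<Sum>j<n. coord x j * coord y j)"
  by (rule inner_fvec_superset) (auto simp: Rn_def not_le [symmetric])

lemma norm_Rn: "x \<in> Rn n \<Longrightarrow> norm x = sqrt (\<Sum>j<n. (coord x j)\<^sup>2)"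
  by (simp add: norm_fvec_def inner_Rn power2_eq_square)

lift_definition mat_vec :: "nat \<Rightarrow> nat \<Rightarrow> (nat \<Rightarrow> nat \<Rightarrow> real) \<Rightarrow> fvec \<Rightarrow> fvec"
  is "\<lambda>m d M x j. if j < m then \<Sum>k<d. M j k * x k else 0"
  by (rule finite_subset [of _ "{..<m}" for m]) auto

lift_definition proj_plus :: "fvec \<Rightarrow> fvec" is "\<lambda>x j. max (x j) 0"
  by (rule finite_subset) auto

definition norm_plus :: "nat \<Rightarrow> fvec \<Rightarrow> real" where
  "norm_plus m x = sqrt (\<Sum>j<m. (max (coord x j) 0)\<^sup>2)"

definition orthant :: "nat \<Rightarrow> fvec set" where
  "orthant m = {x \<in> Rn m. \<forall>j<m. 0 \<le> coord x j}"


section \<open>Extended-real-valued functions on \<open>Rn d\<close>\<close>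

text \<open>The values of such a function outside \<open>Rn d\<close> are never used.\<close>

definition edom :: "nat \<Rightarrow> (fvec \<Rightarrow> ereal) \<Rightarrow> fvec set" where
  "edom d f = {x \<in> Rn d. f x < \<infinity>}"

definition proper_fun :: "nat \<Rightarrow> (fvec \<Rightarrow> ereal) \<Rightarrow> bool" where
  "proper_fun d f \<longleftrightarrow> (\<forall>x\<in>Rn d. f x \<noteq> - \<infinity>) \<and> edom d f \<noteq> {}"

definition closed_fun :: "nat \<Rightarrow> (fvec \<Rightarrow> ereal) \<Rightarrow> bool" where
  "closed_fun d f \<longleftrightarrow> closed {(x, t :: real). x \<in> Rn d \<and> f x \<le> ereal t}"

definition has_affine_minorant :: "nat \<Rightarrow> (fvec \<Rightarrow> ereal) \<Rightarrow> bool" where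
  "has_affine_minorant d f \<longleftrightarrow> (\<exists>a\<in>Rn d. \<exists>c. \<forall>x\<in>Rn d. ereal (inner a x + c) \<le> f x)"

definition conjugate :: "nat \<Rightarrow> (fvec \<Rightarrow> ereal) \<Rightarrow> fvec \<Rightarrow> ereal" where
  "conjugate d f y = (SUP x\<in>Rn d. ereal (inner y x) - f x)"

definition biconjugate :: "nat \<Rightarrow> (fvec \<Rightarrow> ereal) \<Rightarrow> fvec \<Rightarrow> ereal" where
  "biconjugate d f = conjugate d (conjugate d f)"

definition nonconvexity :: "nat \<Rightarrow> (fvec \<Rightarrow> ereal) \<Rightarrow> ereal" where
  "nonconvexity d f = Sup {f (\<Sum>j<p. \<alpha> j *\<^sub>R x j) - (\<Sum>j<p. ereal (\<alpha> j) * f (x j)) | (p :: nat) \<alpha> x.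
     (\<forall>j<p. x j \<in> edom d f \<and> 0 \<le> \<alpha> j) \<and> (\<Sum>j<p. \<alpha> j) = 1}"


section \<open>The separable problem, its bidual and its dual\<close>

record separable =
  blocks :: nat                              \<comment> \<open>\<open>N\<close>; block indices run over \<open>{1..N}\<close>\<close>
  ncons :: nat                                \<comment> \<open>\<open>m\<close>\<close>
  dims :: "nat \<Rightarrow> nat"                       \<comment> \<open>\<open>d\<^sub>i\<close>\<close>
  obj :: "nat \<Rightarrow> fvec \<Rightarrow> ereal"              \<comment> \<open>\<open>f\<^sub>i\<close>\<close>
  mat :: "nat \<Rightarrow> nat \<Rightarrow> nat \<Rightarrow> real"         \<comment> \<open>\<open>mat P i j k\<close> is the entry \<open>(j, k)\<close> of \<open>A\<^sub>i\<close>\<close>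
  rhs :: fvec                                \<comment> \<open>\<open>b\<close>\<close>

definition idx :: "separable \<Rightarrow> nat set" where
  "idx P = {1..blocks P}"

definition domf :: "separable \<Rightarrow> nat \<Rightarrow> fvec set" where
  "domf P i = edom (dims P i) (obj P i)"

definition fbb :: "separable \<Rightarrow> nat \<Rightarrow> fvec \<Rightarrow> ereal" where
  "fbb P i = biconjugate (dims P i) (obj P i)"

definition Xset :: "separable \<Rightarrow> nat \<Rightarrow> fvec set" where
  "Xset P i = convex hull (domf P i)"

definition Aop :: "separable \<Rightarrow> nat \<Rightarrow> fvec \<Rightarrow> fvec" where
  "Aop P i = mat_vec (ncons P) (dims P i) (mat P i)"

text \<open>
  Only used at points of \<open>dom f\<^sub>i\<close>, where \<open>f\<^sub>i\<close> is finite (for the final output see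
  \<open>recovered_in_domf\<close> below).
\<close>

definition fval :: "separable \<Rightarrow> nat \<Rightarrow> fvec \<Rightarrow> real" where
  "fval P i x = real_of_ereal (obj P i x)"

definition separable_problem :: "separable \<Rightarrow> bool" where
  "separable_problem P \<longleftrightarrow> 1 \<le> blocks P \<and> rhs P \<in> Rn (ncons P) \<and>
     (\<forall>i\<in>idx P. closed_fun (dims P i) (obj P i) \<and> proper_fun (dims P i) (obj P i) \<and>
        has_affine_minorant (dims P i) (obj P i) \<and> compact (domf P i))"

definition bidual_feasible :: "separable \<Rightarrow> (nat \<Rightarrow> fvec) set" where
  "bidual_feasible P = {x. (\<forall>i\<in>idx P. x i \<in> Xset P i) \<and>
     (\<forall>j<ncons P. coord ((1 / real (blocks P)) *\<^sub>R (\<Sum>i\<in>idx P. Aop P i (x i))) j \<le> coord (rhs P) j)}"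

definition bidual_value :: "separable \<Rightarrow> ereal" where
  "bidual_value P =
     (INF x\<in>bidual_feasible P. ereal (1 / real (blocks P)) * (\<Sum>i\<in>idx P. fbb P i (x i)))"

definition dual :: "separable \<Rightarrow> fvec \<Rightarrow> ereal" where
  "dual P lam = ereal (- inner lam (rhs P)) + ereal (1 / real (blocks P)) *
     (\<Sum>i\<in>idx P. INF x\<in>Xset P i. fbb P i x + ereal (inner lam (Aop P i x)))"

definition dval :: "separable \<Rightarrow> fvec \<Rightarrow> real" where
  "dval P lam = real_of_ereal (dual P lam)"

definition strong_duality :: "separable \<Rightarrow> fvec \<Rightarrow> bool" where
  "strong_duality P lamstar \<longleftrightarrow> lamstar \<in> orthant (ncons P) \<and>
     (\<forall>lam\<in>orthant (ncons P). dual P lam \<le> dual P lamstar) \<and>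
     dual P lamstar = bidual_value P"

definition Gtilde :: "separable \<Rightarrow> real" where
  "Gtilde P = Sup {norm (Aop P i x - rhs P) | i x. i \<in> idx P \<and> x \<in> Xset P i}"

definition Hsup :: "separable \<Rightarrow> ereal" where
  "Hsup P = Sup {\<bar>fbb P i x\<bar> | i x. i \<in> idx P \<and> x \<in> Xset P i}"

definition Cset :: "separable \<Rightarrow> nat \<Rightarrow> (real \<times> fvec) set" where
  "Cset P i = {(real_of_ereal (fbb P i x), Aop P i x) | x. x \<in> Xset P i}"

definition Dconst :: "separable \<Rightarrow> real" where
  "Dconst P =
     sqrt ((1 / real (blocks P)) * (\<Sum>i\<in>idx P. (diameter (convex hull (Cset P i)))\<^sup>2))"


section \<open>The two-stage algorithm\<close>

text \<open>\<open>orc i (\<gamma>, \<lambda>)\<close> is the answer \<open>x\<^sub>i\<^sup>*((\<gamma>, \<lambda>))\<close> of the oracle.\<close>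

definition is_oracle :: "separable \<Rightarrow> (nat \<Rightarrow> real \<times> fvec \<Rightarrow> fvec) \<Rightarrow> bool" where
  "is_oracle P orc \<longleftrightarrow> (\<forall>i\<in>idx P. \<forall>\<gamma>\<ge>0. \<forall>lam\<in>Rn (ncons P).
     is_arg_min (\<lambda>x. ereal \<gamma> * fbb P i x + ereal (inner lam (Aop P i x)))
       (\<lambda>x. x \<in> Xset P i) (orc i (\<gamma>, lam)) \<and>
     orc i (\<gamma>, lam) \<in> domf P i \<and>
     obj P i (orc i (\<gamma>, lam)) = fbb P i (orc i (\<gamma>, lam)))"

subsection \<open>Stage 1: stochastic dual subgradient\<close>

text \<open>\<open>is t\<close> is the block sampled at iteration \<open>t \<le> T - 2\<close>; iteration \<open>T - 1\<close> is a full step.\<close>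

definition sg_dir ::
  "separable \<Rightarrow> (nat \<Rightarrow> real \<times> fvec \<Rightarrow> fvec) \<Rightarrow> nat \<Rightarrow> (nat \<Rightarrow> nat) \<Rightarrow> nat \<Rightarrow> fvec \<Rightarrow> fvec" where
  "sg_dir P orc T is t lam =
     (if t + 1 < T then Aop P (is t) (orc (is t) (1, lam)) - rhs P
      else (1 / real (blocks P)) *\<^sub>R (\<Sum>i\<in>idx P. Aop P i (orc i (1, lam))) - rhs P)"

primrec sg_iter ::
  "separable \<Rightarrow> (nat \<Rightarrow> real \<times> fvec \<Rightarrow> fvec) \<Rightarrow> (nat \<Rightarrow> real) \<Rightarrow> fvec \<Rightarrow> nat \<Rightarrow> (nat \<Rightarrow> nat)
     \<Rightarrow> nat \<Rightarrow> fvec" where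
  "sg_iter P orc \<alpha> lam0 T is 0 = lam0"
| "sg_iter P orc \<alpha> lam0 T is (Suc t) =
     proj_plus (sg_iter P orc \<alpha> lam0 T is t +
       \<alpha> t *\<^sub>R sg_dir P orc T is t (sg_iter P orc \<alpha> lam0 T is t))"

definition sg_avg ::
  "separable \<Rightarrow> (nat \<Rightarrow> real \<times> fvec \<Rightarrow> fvec) \<Rightarrow> (nat \<Rightarrow> real) \<Rightarrow> fvec \<Rightarrow> nat \<Rightarrow> (nat \<Rightarrow> nat)
     \<Rightarrow> fvec" where
  "sg_avg P orc \<alpha> lam0 T is = (1 / real T) *\<^sub>R (\<Sum>t<T. sg_iter P orc \<alpha> lam0 T is t)"

subsection \<open>Stage 2: block-coordinate Frank-Wolfe\<close>

text \<open>
  The state is the family \<open>(\<beta>\<^sub>i, z\<^sub>i)\<close>, \<open>v\<close> is the dual value at the averaged multiplier, and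
  \<open>js k\<close> is the block sampled at iteration \<open>k\<close>.
\<close>

definition fw_dir :: "separable \<Rightarrow> real \<Rightarrow> (nat \<Rightarrow> real \<times> fvec) \<Rightarrow> real \<times> fvec" where
  "fw_dir P v s = (max ((\<Sum>i\<in>idx P. fst (s i)) - v) 0, proj_plus ((\<Sum>i\<in>idx P. snd (s i)) - rhs P))"

definition fw_step :: "separable \<Rightarrow> nat \<Rightarrow> real" where
  "fw_step P k = 2 * real (blocks P) / (real k + 2 * real (blocks P))"

primrec fw_state ::
  "separable \<Rightarrow> (nat \<Rightarrow> real \<times> fvec \<Rightarrow> fvec) \<Rightarrow> (nat \<Rightarrow> fvec) \<Rightarrow> real \<Rightarrow> (nat \<Rightarrow> nat) \<Rightarrow> nat
     \<Rightarrow> nat \<Rightarrow> real \<times> fvec" where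
  "fw_state P orc x0 v js 0 =
     (\<lambda>i. (1 / real (blocks P)) *\<^sub>R (real_of_ereal (fbb P i (x0 i)), Aop P i (x0 i)))"
| "fw_state P orc x0 v js (Suc k) =
     (let s = fw_state P orc x0 v js k; i = js k; x = orc i (fw_dir P v s) in
      s(i := (1 - fw_step P k) *\<^sub>R s i +
             (fw_step P k / real (blocks P)) *\<^sub>R (fval P i x, Aop P i x)))"

text \<open>
  The points \<open>x\<^sub>i\<^sup>l\<close> from which the output is assembled: \<open>l = 0\<close> is the initial point of block \<open>i\<close>
  and \<open>l = k + 1\<close> the oracle answer of iteration \<open>k\<close>; the index set \<open>Q\<^sub>i\<close> keeps the iterations
  that sampled block \<open>i\<close>.
\<close>

definition fw_point ::
  "separable \<Rightarrow> (nat \<Rightarrow> real \<times> fvec \<Rightarrow> fvec) \<Rightarrow> (nat \<Rightarrow> fvec) \<Rightarrow> real \<Rightarrow> (nat \<Rightarrow> nat) \<Rightarrow> nat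
     \<Rightarrow> nat \<Rightarrow> fvec" where
  "fw_point P orc x0 v js i l =
     (case l of 0 \<Rightarrow> x0 i | Suc k \<Rightarrow> orc i (fw_dir P v (fw_state P orc x0 v js k)))"

definition Qset :: "nat \<Rightarrow> (nat \<Rightarrow> nat) \<Rightarrow> nat \<Rightarrow> nat set" where
  "Qset K js i = insert 0 {Suc k | k. k < K \<and> js k = i}"

subsection \<open>Caratheodory step\<close>

text \<open>
  \<open>out\<close> stands for \<open>(\<beta>\<^sup>K, z\<^sup>K)\<close>, \<open>x i l\<close> for \<open>x\<^sub>i\<^sup>l\<close>, \<open>w i l\<close> for the new weights and \<open>sel i\<close> for the
  index \<open>l\<^sub>i\<close> of a block outside \<open>S\<close>.
\<close>

definition caratheodory_decomp ::
  "separable \<Rightarrow> (nat \<Rightarrow> nat set) \<Rightarrow> (nat \<Rightarrow> nat \<Rightarrow> fvec) \<Rightarrow> real \<times> fvec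
     \<Rightarrow> nat set \<Rightarrow> (nat \<Rightarrow> nat \<Rightarrow> real) \<Rightarrow> (nat \<Rightarrow> nat) \<Rightarrow> bool" where
  "caratheodory_decomp P Q x out S w sel \<longleftrightarrow>
     (\<forall>i\<in>idx P. (\<forall>l\<in>Q i. 0 \<le> w i l) \<and> (\<Sum>l\<in>Q i. w i l) = 1) \<and>
     card {(i, l). i \<in> idx P \<and> l \<in> Q i \<and> w i l \<noteq> 0} \<le> 1 + ncons P + blocks P \<and>
     S \<subseteq> idx P \<and> card S \<le> ncons P + 1 \<and> (\<forall>i\<in>idx P - S. sel i \<in> Q i) \<and>
     out = (\<Sum>i\<in>S. \<Sum>l\<in>Q i. (w i l / real (blocks P)) *\<^sub>R (fval P i (x i l), Aop P i (x i l))) +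
       (\<Sum>i\<in>idx P - S. (1 / real (blocks P)) *\<^sub>R (fval P i (x i (sel i)), Aop P i (x i (sel i))))"

definition recovered ::
  "(nat \<Rightarrow> nat set) \<Rightarrow> (nat \<Rightarrow> nat \<Rightarrow> fvec) \<Rightarrow> nat set \<Rightarrow> (nat \<Rightarrow> nat \<Rightarrow> real) \<Rightarrow> (nat \<Rightarrow> nat)
     \<Rightarrow> nat \<Rightarrow> fvec" where
  "recovered Q x S w sel i = (if i \<in> S then \<Sum>l\<in>Q i. w i l *\<^sub>R x i l else x i (sel i))"

lemma recovered_in_domf:
  assumes "caratheodory_decomp P Q x out S w sel" "i \<in> idx P" "finite (Q i)" "convex (domf P i)"
    and "\<And>l. l \<in> Q i \<Longrightarrow> x i l \<in> domf P i"
  shows "recovered Q x S w sel i \<in> domf P i"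
  using assms unfolding caratheodory_decomp_def recovered_def
  by (auto intro!: convex_sum)

subsection \<open>Randomness and cost\<close>

definition samples :: "separable \<Rightarrow> nat \<Rightarrow> nat \<Rightarrow> ((nat \<Rightarrow> nat) \<times> (nat \<Rightarrow> nat)) pmf" where
  "samples P T K = pair_pmf (Pi_pmf {..<T - 1} 0 (\<lambda>_. pmf_of_set (idx P)))
                            (Pi_pmf {..<K} 0 (\<lambda>_. pmf_of_set (idx P)))"

text \<open>Stage 1 makes one call in each of its first \<open>T - 1\<close> iterations and \<open>N\<close> in the last one.\<close>

definition oracle_calls :: "separable \<Rightarrow> nat \<Rightarrow> nat \<Rightarrow> nat" where
  "oracle_calls P T K = (T - 1) + blocks P + K"

definition run_v ::
  "separable \<Rightarrow> (nat \<Rightarrow> real \<times> fvec \<Rightarrow> fvec) \<Rightarrow> (nat \<Rightarrow> real) \<Rightarrow> fvec \<Rightarrow> nat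
     \<Rightarrow> (nat \<Rightarrow> nat) \<times> (nat \<Rightarrow> nat) \<Rightarrow> real" where
  "run_v P orc \<alpha> lam0 T \<omega> = dval P (sg_avg P orc \<alpha> lam0 T (fst \<omega>))"

definition run_point ::
  "separable \<Rightarrow> (nat \<Rightarrow> real \<times> fvec \<Rightarrow> fvec) \<Rightarrow> (nat \<Rightarrow> real) \<Rightarrow> fvec \<Rightarrow> (nat \<Rightarrow> fvec) \<Rightarrow> nat
     \<Rightarrow> (nat \<Rightarrow> nat) \<times> (nat \<Rightarrow> nat) \<Rightarrow> nat \<Rightarrow> nat \<Rightarrow> fvec" where
  "run_point P orc \<alpha> lam0 x0 T \<omega> = fw_point P orc x0 (run_v P orc \<alpha> lam0 T \<omega>) (snd \<omega>)"

definition run_out ::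
  "separable \<Rightarrow> (nat \<Rightarrow> real \<times> fvec \<Rightarrow> fvec) \<Rightarrow> (nat \<Rightarrow> real) \<Rightarrow> fvec \<Rightarrow> (nat \<Rightarrow> fvec) \<Rightarrow> nat
     \<Rightarrow> nat \<Rightarrow> (nat \<Rightarrow> nat) \<times> (nat \<Rightarrow> nat) \<Rightarrow> real \<times> fvec" where
  "run_out P orc \<alpha> lam0 x0 T K \<omega> =
     (\<Sum>i\<in>idx P. fw_state P orc x0 (run_v P orc \<alpha> lam0 T \<omega>) (snd \<omega>) K i)"

text \<open>
  \<open>xbar\<close> is a possible final output of the algorithm, as a function of the samples: on every sample
  path some decomposition delivered by the Caratheodory step is used.
\<close>

definition two_stage_output ::
  "separable \<Rightarrow> (nat \<Rightarrow> real \<times> fvec \<Rightarrow> fvec) \<Rightarrow> (nat \<Rightarrow> real) \<Rightarrow> fvec \<Rightarrow> (nat \<Rightarrow> fvec) \<Rightarrow> nat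
     \<Rightarrow> nat \<Rightarrow> ((nat \<Rightarrow> nat) \<times> (nat \<Rightarrow> nat) \<Rightarrow> nat \<Rightarrow> fvec) \<Rightarrow> bool" where
  "two_stage_output P orc \<alpha> lam0 x0 T K xbar \<longleftrightarrow>
     (\<forall>\<omega>\<in>set_pmf (samples P T K). \<exists>S w sel.
        caratheodory_decomp P (Qset K (snd \<omega>)) (run_point P orc \<alpha> lam0 x0 T \<omega>)
          (run_out P orc \<alpha> lam0 x0 T K \<omega>) S w sel \<and>
        xbar \<omega> = recovered (Qset K (snd \<omega>)) (run_point P orc \<alpha> lam0 x0 T \<omega>) S w sel)"

end

theory Submission
  imports Defs
begin

text \<open>
  Stage 1 is a projected stochastic supergradient ascent on the concave dual, so the expected dual gap
  \<open>\<delta> = d\<^sup>* - d(\<lambda>_avg)\<close> is at most \<open>G (\<Parallel>\<lambda>\<^sup>*\<Parallel>\<^sup>2 + \<Lambda>\<^sup>2) / (2 \<Lambda> sqrt T)\<close>.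

  Stage 2 minimises half the squared length \<open>V\<close> of the residual \<open>(max (\<beta> - v) 0, \<Pi>\<^sub>+ (z - b))\<close>, where
  \<open>v = d(\<lambda>_avg)\<close>.  Comparing the oracle answers with nearly optimal points of the bidual, and averaging
  over the sampled block, gives with \<open>n = k + 2 N\<close>
  \<open>E V(k+1) \<le> (1 - 4 / n) V(k) + (4 / n) \<delta> sqrt V(k) + 4 D\<^sup>2 / n\<^sup>2\<close>.
  A quarter of the contraction absorbs the middle term; the remaining factor \<open>1 - 3 / n\<close> makes the
  initial value decay like \<open>(N / n)\<^sup>3\<close>, which is where \<open>N / \<epsilon> powr (2 / 3)\<close> comes from.  Both quantities to be
  bounded are at most \<open>sqrt V(K)\<close>, up to the term \<open>(m + 1) / N max \<rho>(f\<^sub>i)\<close> lost when the at most \<open>m + 1\<close>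
  mixed blocks are replaced by their averages.
\<close>

section \<open>Projection onto the orthant\<close>

lemma Rn_zero [simp]: "0 \<in> Rn n"
  and Rn_add: "x \<in> Rn n \<Longrightarrow> y \<in> Rn n \<Longrightarrow> x + y \<in> Rn n"
  and Rn_diff: "x \<in> Rn n \<Longrightarrow> y \<in> Rn n \<Longrightarrow> x - y \<in> Rn n"
  and Rn_scaleR: "x \<in> Rn n \<Longrightarrow> c *\<^sub>R x \<in> Rn n"
  and Rn_sum: "(\<And>i. i \<in> I \<Longrightarrow> g i \<in> Rn n) \<Longrightarrow> sum g I \<in> Rn n"
  by (auto simp: Rn_def)

lemma coord_proj_plus [simp]: "coord (proj_plus x) j = max (coord x j) 0"
  by transfer simp

lemma proj_plus_Rn: "x \<in> Rn n \<Longrightarrow> proj_plus x \<in> Rn n"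
  by (simp add: Rn_def)

lemma proj_plus_orthant: "x \<in> Rn n \<Longrightarrow> proj_plus x \<in> orthant n"
  by (simp add: orthant_def proj_plus_Rn)

lemma norm_Rn_power2: "x \<in> Rn n \<Longrightarrow> (norm x)\<^sup>2 = (\<Sum>j<n. (coord x j)\<^sup>2)"
  by (simp add: norm_Rn sum_nonneg)

lemma norm_plus_eq_norm_proj_plus: "x \<in> Rn n \<Longrightarrow> norm_plus n x = norm (proj_plus x)"
  by (simp add: norm_plus_def norm_Rn [OF proj_plus_Rn])

lemma inner_proj_plus: "x \<in> Rn n \<Longrightarrow> inner (proj_plus x) x = (norm (proj_plus x))\<^sup>2"
  by (simp add: norm_Rn_power2 [OF proj_plus_Rn] inner_Rn [OF proj_plus_Rn])
    (auto intro!: sum.cong simp: max_def power2_eq_square)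

text \<open>Quadratic upper bound from smoothness: the derivative \<open>2 * max a 0\<close> of the
  squared positive part is 2-Lipschitz.\<close>

lemma max_zero_add_power2_le:
  fixes a e :: real
  shows "(max (a + e) 0)\<^sup>2 \<le> (max a 0)\<^sup>2 + 2 * (max a 0 * e) + e\<^sup>2"
proof -
  consider "a \<ge> 0" "a + e \<ge> 0" | "a \<ge> 0" "a + e < 0" | "a < 0" "a + e \<ge> 0" | "a < 0" "a + e < 0"
    by linarith
  then show ?thesis
  proof cases
    case 2
    then show ?thesis using zero_le_power2 [of "a + e"] by (simp add: power2_sum)
  next
    case 3
    then show ?thesis using power_mono [of "a + e" e 2] by simp
  qed (simp_all add: power2_sum)
qed

lemma norm_proj_plus_add_power2_le:
  assumes "x \<in> Rn n" "e \<in> Rn n"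
  shows "(norm (proj_plus (x + e)))\<^sup>2
           \<le> (norm (proj_plus x))\<^sup>2 + 2 * inner (proj_plus x) e + (norm e)\<^sup>2"
proof -
  have "(norm (proj_plus (x + e)))\<^sup>2 = (\<Sum>j<n. (max (coord x j + coord e j) 0)\<^sup>2)"
    by (simp add: norm_Rn_power2 [OF proj_plus_Rn [OF Rn_add [OF assms]]])
  also have "\<dots> \<le> (\<Sum>j<n. (max (coord x j) 0)\<^sup>2 + 2 * (max (coord x j) 0 * coord e j) + (coord e j)\<^sup>2)"
    by (intro sum_mono max_zero_add_power2_le)
  also have "\<dots> = (norm (proj_plus x))\<^sup>2 + 2 * inner (proj_plus x) e + (norm e)\<^sup>2"
    using assms
    by (simp add: norm_Rn_power2 [OF proj_plus_Rn] norm_Rn_power2 inner_Rn [OF proj_plus_Rn]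
        sum.distrib sum_distrib_left)
  finally show ?thesis .
qed

text \<open>Coordinatewise, clipping at zero brings a number no farther from any nonnegative
  one.\<close>

lemma norm_proj_plus_diff_le:
  assumes "x \<in> Rn n" "y \<in> orthant n"
  shows "norm (proj_plus x - y) \<le> norm (x - y)"
proof -
  have y: "y \<in> Rn n" and pos: "\<And>j. j < n \<Longrightarrow> 0 \<le> coord y j"
    using assms(2) by (auto simp: orthant_def)
  have "(max (coord x j) 0 - coord y j)\<^sup>2 \<le> (coord x j - coord y j)\<^sup>2" if "j < n" for j
    using pos [OF that] by (intro iffD1 [OF abs_le_square_iff]) auto
  then have "(norm (proj_plus x - y))\<^sup>2 \<le> (norm (x - y))\<^sup>2"
    by (simp add: norm_Rn_power2 [OF Rn_diff [OF assms(1) y]]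
        norm_Rn_power2 [OF Rn_diff [OF proj_plus_Rn [OF assms(1)] y]])
      (auto intro: sum_mono)
  then show ?thesis by (rule power2_le_imp_le) simp
qed

lemma norm_proj_plus_le: "x \<in> Rn n \<Longrightarrow> norm (proj_plus x) \<le> norm x"
  using norm_proj_plus_diff_le [of x n 0] by (simp add: orthant_def)

section \<open>Matrices as linear maps that preserve boundedness\<close>

lemma coord_mat_vec: "coord (mat_vec m d M x) j = (if j < m then \<Sum>k<d. M j k * coord x k else 0)"
  by transfer simp

lemma mat_vec_Rn: "mat_vec m d M x \<in> Rn m"
  by (simp add: Rn_def coord_mat_vec)

lemma linear_mat_vec: "linear (mat_vec m d M)"
  by (rule linearI; rule fvec_eqI)
    (simp_all add: coord_mat_vec algebra_simps sum.distrib sum_distrib_left)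

lemma abs_coord_le_norm: "\<bar>coord x j\<bar> \<le> norm x"
proof -
  \<comment> \<open>\<open>j\<close> is inserted because it may lie outside the support of
    \<open>x\<close>.\<close>
  let ?J = "insert j {k. coord x k \<noteq> 0}"
  have "(coord x j)\<^sup>2 \<le> (\<Sum>k\<in>?J. (coord x k)\<^sup>2)"
    by (rule member_le_sum) auto
  also have "\<dots> = (norm x)\<^sup>2"
    by (subst power2_norm_eq_inner, subst inner_fvec_superset [of ?J]) (auto simp: power2_eq_square)
  finally show ?thesis
    by (metis abs_le_square_iff abs_norm_cancel)
qed

text \<open>\<open>fvec\<close> is infinite-dimensional, so boundedness does not come with
  linearity; it comes from the finitely many entries of \<open>M\<close>.\<close>

lemma bounded_mat_vec_image:
  assumes "bounded S"
  shows "bounded (mat_vec m d M ` S)"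
proof -
  obtain B where B: "\<And>x. x \<in> S \<Longrightarrow> norm x \<le> B"
    using assms by (auto simp: bounded_iff)
  have "norm (mat_vec m d M x) \<le> (\<Sum>j<m. \<Sum>k<d. \<bar>M j k\<bar> * B)" if "x \<in> S" for x
  proof -
    have "norm (mat_vec m d M x) \<le> (\<Sum>j<m. \<bar>coord (mat_vec m d M x) j\<bar>)"
      using L2_set_le_sum_abs [of "coord (mat_vec m d M x)" "{..<m}"]
      by (simp add: norm_Rn [OF mat_vec_Rn] L2_set_def)
    also have "\<dots> \<le> (\<Sum>j<m. \<Sum>k<d. \<bar>M j k\<bar> * B)"
    proof (intro sum_mono)
      fix j assume "j \<in> {..<m}"
      then have "\<bar>coord (mat_vec m d M x) j\<bar> \<le> (\<Sum>k<d. \<bar>M j k * coord x k\<bar>)"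
        by (simp add: coord_mat_vec sum_abs)
      also have "\<dots> \<le> (\<Sum>k<d. \<bar>M j k\<bar> * B)"
        unfolding abs_mult
        by (intro sum_mono mult_left_mono order_trans [OF abs_coord_le_norm B [OF that]]) simp
      finally show "\<bar>coord (mat_vec m d M x) j\<bar> \<le> (\<Sum>k<d. \<bar>M j k\<bar> * B)" .
    qed
    finally show ?thesis .
  qed
  then show ?thesis unfolding bounded_iff by blast
qed

text \<open>Gradient of half the squared distance to the cone of pairs with nonpositive entries. At
  \<open>(\<beta> - v, z - b)\<close> it is the oracle query of stage 2.\<close>

definition pos_part :: "real \<times> fvec \<Rightarrow> real \<times> fvec" where
  "pos_part y = (max (fst y) 0, proj_plus (snd y))"

lemma norm_prod_power2: "(norm y)\<^sup>2 = (norm (fst y))\<^sup>2 + (norm (snd y))\<^sup>2"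
  by (simp add: norm_prod_def)

text \<open>The two component bounds add up; the sum serves as the descent lemma of stage 2.\<close>

lemma norm_pos_part_add_power2_le:
  assumes "snd y \<in> Rn n" "snd e \<in> Rn n"
  shows "(norm (pos_part (y + e)))\<^sup>2
    \<le> (norm (pos_part y))\<^sup>2 + 2 * inner (pos_part y) e + (norm e)\<^sup>2"
  using max_zero_add_power2_le [of "fst y" "fst e"] norm_proj_plus_add_power2_le [OF assms]
  unfolding norm_prod_power2 [of "pos_part _"] norm_prod_power2 [of e]
  by (simp add: pos_part_def inner_prod_def algebra_simps)

lemma inner_pos_part:
  assumes "snd y \<in> Rn n"
  shows "inner (pos_part y) y = (norm (pos_part y))\<^sup>2"
  using inner_proj_plus [OF assms]
  unfolding norm_prod_power2 [of "pos_part y"]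
  by (simp add: pos_part_def inner_prod_def max_def power2_eq_square)

lemma fw_dir_eq_pos_part: "fw_dir P v s = pos_part ((\<Sum>i\<in>idx P. s i) - (v, rhs P))"
  by (simp add: fw_dir_def pos_part_def fst_sum snd_sum)

section \<open>Expectations over independent draws\<close>

text \<open>Fubini for finite supports, where every integral is a finite sum. It separates the draws
  of stage 1 from those of stage 2.\<close>

lemma expectation_pair_pmf:
  fixes h :: "'a \<times> 'b \<Rightarrow> real"
  assumes "finite (set_pmf p)" "finite (set_pmf q)"
  shows "measure_pmf.expectation (pair_pmf p q) h =
    measure_pmf.expectation p (\<lambda>a. measure_pmf.expectation q (\<lambda>b. h (a, b)))"
proof -
  have "measure_pmf.expectation (pair_pmf p q) h =
      (\<Sum>(a, b)\<in>set_pmf p \<times> set_pmf q. pmf p a * (pmf q b * h (a, b)))"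
    using assms by (subst integral_measure_pmf_real [of "set_pmf p \<times> set_pmf q"])
      (auto simp: pmf_pair mult_ac intro!: sum.cong)
  also have "\<dots> = (\<Sum>a\<in>set_pmf p. \<Sum>b\<in>set_pmf q. pmf p a * (pmf q b * h (a, b)))"
    by (simp add: sum.cartesian_product)
  also have "\<dots> = measure_pmf.expectation p (\<lambda>a. measure_pmf.expectation q (\<lambda>b. h (a, b)))"
    using assms by (simp add: integral_measure_pmf_real [OF assms(1)]
        integral_measure_pmf_real [OF assms(2)] sum_distrib_left mult_ac)
  finally show ?thesis .
qed

lemma finite_set_Pi_pmf:
  assumes "finite I" "\<And>i. i \<in> I \<Longrightarrow> finite (set_pmf (p i))"
  shows "finite (set_pmf (Pi_pmf I d p))"
  using assms by (subst set_Pi_pmf) auto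

text \<open>Drawing coordinate \<open>k\<close> again, independently of the rest, overwrites the
  first draw and leaves the law unchanged.\<close>

lemma Pi_pmf_resample:
  assumes "finite I" "k \<in> I"
  shows "Pi_pmf I d p = bind_pmf (Pi_pmf I d p) (\<lambda>f. map_pmf (\<lambda>y. f(k := y)) (p k))"
proof -
  let ?R = "Pi_pmf (I - {k}) d p"
  have I: "Pi_pmf I d p = bind_pmf (p k) (\<lambda>y. bind_pmf ?R (\<lambda>f. return_pmf (f(k := y))))"
    using Pi_pmf_insert' [of "I - {k}" k d p] assms by (simp add: insert_absorb)
  show ?thesis
    unfolding I by (simp add: bind_assoc_pmf bind_return_pmf map_pmf_def)
      (subst bind_commute_pmf, simp)
qed

text \<open>Stands in for conditioning on all draws but the \<open>k\<close>-th: under the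
  expectation, \<open>g\<close> may be replaced by its average over that draw.\<close>

lemma expectation_Pi_pmf_resample:
  fixes g :: "('a \<Rightarrow> 'b) \<Rightarrow> real" and d :: 'b
  assumes I: "finite I" "k \<in> I" and A: "finite A" "A \<noteq> {}"
  defines "M \<equiv> Pi_pmf I d (\<lambda>_. pmf_of_set A)"
  shows "measure_pmf.expectation M g =
    measure_pmf.expectation M (\<lambda>f. (\<Sum>y\<in>A. g (f(k := y))) / real (card A))"
proof -
  have fin: "finite (set_pmf M)"
    unfolding M_def using I A by (intro finite_set_Pi_pmf) auto
  have "measure_pmf.expectation M g =
      measure_pmf.expectation (bind_pmf M (\<lambda>f. map_pmf (\<lambda>y. f(k := y)) (pmf_of_set A))) g"
    unfolding M_def using Pi_pmf_resample [OF I, of d "\<lambda>_. pmf_of_set A"] by simp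
  also have "\<dots> = (\<Sum>f\<in>set_pmf M. pmf M f *\<^sub>R
      measure_pmf.expectation (map_pmf (\<lambda>y. f(k := y)) (pmf_of_set A)) g)"
    using fin A by (intro pmf_expectation_bind) auto
  also have "\<dots> = (\<Sum>f\<in>set_pmf M. pmf M f * ((\<Sum>y\<in>A. g (f(k := y))) / real (card A)))"
    using A by (simp add: integral_pmf_of_set)
  also have "\<dots> = measure_pmf.expectation M (\<lambda>f. (\<Sum>y\<in>A. g (f(k := y))) / real (card A))"
    by (simp add: integral_measure_pmf_real [OF fin] sum_divide_distrib mult_ac)
  finally show ?thesis .
qed

lemma expectation_pmf_mono:
  fixes f g :: "'a \<Rightarrow> real"
  assumes "finite (set_pmf p)" "\<And>x. x \<in> set_pmf p \<Longrightarrow> f x \<le> g x"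
  shows "measure_pmf.expectation p f \<le> measure_pmf.expectation p g"
  using assms by (intro integral_mono_AE integrable_measure_pmf_finite AE_pmfI)

text \<open>Jensen's inequality, read off from the nonnegativity of the variance.\<close>

lemma expectation_pmf_power2_le:
  fixes f :: "'a \<Rightarrow> real"
  assumes "finite (set_pmf p)"
  shows "(measure_pmf.expectation p f)\<^sup>2 \<le> measure_pmf.expectation p (\<lambda>x. (f x)\<^sup>2)"
proof -
  have "0 \<le> measure_pmf.variance p f" by (simp add: integral_nonneg_AE)
  then show ?thesis
    by (subst (asm) measure_pmf.variance_eq)
      (simp_all add: integrable_measure_pmf_finite assms)
qed

section \<open>Numerical estimates\<close>

text \<open>
  \<open>V\<close> is the expected squared residual after \<open>k\<close> Frank-Wolfe steps, \<open>n = k + 2 N\<close>, \<open>a = 2 N\<close> and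
  \<open>d\<close> the squared dual gap left by stage 1.
\<close>

lemma residual_recursion:
  fixes n :: nat
  assumes n: "2 \<le> n" and V: "0 \<le> V" "V \<le> 2 * d + Y * (a / n) ^ 3 + c / n"
    and nonneg: "0 \<le> d" "0 \<le> Y" "0 \<le> a" "0 \<le> c"
  shows "(1 - 3 / n) * V + 4 / n * d + c / n\<^sup>2
    \<le> 2 * d + Y * (a / Suc n) ^ 3 + c / Suc n"
\<comment> \<open>For \<open>n = 2\<close> the factor \<open>1 - 3 / n\<close> is negative, so the
  upper bound on \<open>V\<close> cannot be multiplied by it; the product is dropped because
  \<open>V\<close> is nonnegative.\<close>
proof (cases "n = 2")
  case True
  then have "(1 - 3 / n) * V + 4 / n * d + c / n\<^sup>2 = - (V / 2) + 2 * d + c / 4"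
    by simp
  also have "\<dots> \<le> 2 * d + Y * (a / 3) ^ 3 + c / 3"
  proof -
    have "0 \<le> Y * (a / 3) ^ 3" using nonneg by simp
    then show ?thesis using V(1) nonneg by linarith
  qed
  finally show ?thesis by (simp add: True)
next
  case False
  with n have n: "3 \<le> n" by simp
  define r where "r = real n"
  have r: "3 \<le> r" using n by (simp add: r_def)
  have "(1 - 3 / r) * V \<le> (1 - 3 / r) * (2 * d + Y * (a / r) ^ 3 + c / r)"
    using V r by (intro mult_left_mono) (auto simp: r_def)
  moreover have "(1 - 3 / r) * (Y * (a / r) ^ 3) \<le> Y * (a / (r + 1)) ^ 3"
  proof -
    \<comment> \<open>Bernoulli's inequality bounds the contraction factor by the ratio of
      consecutive cubes, which is why the initial term decays cubically.\<close>
    have "1 - 3 / r \<le> 1 + real 3 * (- (1 / (r + 1)))"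
      using r by (simp add: field_simps)
    also have "\<dots> \<le> (1 + - (1 / (r + 1))) ^ 3"
      using r by (intro Bernoulli_inequality) (simp add: field_simps)
    also have "1 + - (1 / (r + 1)) = r / (r + 1)"
      using r by (simp add: field_simps)
    finally have "(1 - 3 / r) * (Y * (a / r) ^ 3) \<le> (r / (r + 1)) ^ 3 * (Y * (a / r) ^ 3)"
      using nonneg r by (intro mult_right_mono) auto
    also have "\<dots> = Y * (a / (r + 1)) ^ 3"
      using r by (simp add: power_divide)
    finally show ?thesis .
  qed
  moreover have "(1 - 3 / r) * (c / r) + c / r\<^sup>2 \<le> c / (r + 1)"
  proof -
    \<comment> \<open>The left side is \<open>1 / r - 2 / r\<^sup>2\<close>, whereas
      \<open>1 / r\<close> exceeds \<open>1 / (r + 1)\<close> by only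
      \<open>1 / (r * (r + 1))\<close>.\<close>
    have "(1 - 3 / r) * (1 / r) + 1 / r\<^sup>2 \<le> 1 / (r + 1)"
      using r by (simp add: field_simps power2_eq_square)
    then have "c * ((1 - 3 / r) * (1 / r) + 1 / r\<^sup>2) \<le> c * (1 / (r + 1))"
      using nonneg by (intro mult_left_mono)
    then show ?thesis by (simp add: algebra_simps)
  qed
  moreover have "(1 - 3 / r) * (2 * d) + 4 / r * d \<le> 2 * d"
    using nonneg r by (simp add: field_simps)
  ultimately have "(1 - 3 / r) * V + 4 / r * d + c / r\<^sup>2 \<le> 2 * d + Y * (a / (r + 1)) ^ 3 + c / (r + 1)"
    by (simp only: distrib_left)
  then show ?thesis by (simp add: r_def add.commute)
qed

text \<open>The first and third requirements need \<open>T\<close> of order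
  \<open>1 / \<epsilon>\<^sup>2\<close> and are paid by \<open>c1\<close>; the second needs order
  \<open>N / \<epsilon> powr (2 / 3)\<close> and is paid by \<open>c2\<close>. The final
  \<open>+ 1\<close> keeps \<open>T\<close> positive. For \<open>\<epsilon> \<le> 1\<close> the
  additive constant and the \<open>N\<close> calls of the full step are absorbed into the two
  rates.\<close>

lemma iteration_count:
  fixes G H D \<Lambda> L \<epsilon> :: real and N :: nat
  assumes \<Lambda>: "0 < \<Lambda>" and \<epsilon>: "0 < \<epsilon>" and N: "1 \<le> N"
  defines "c1 \<equiv> 36 * D\<^sup>2 + (2 * G * (L\<^sup>2 + \<Lambda>\<^sup>2) / \<Lambda>)\<^sup>2"
    and "c2 \<equiv> 2 * (9 * (8 * H\<^sup>2 + G\<^sup>2) + 1)"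
  defines "T \<equiv> nat \<lceil>c1 / \<epsilon>\<^sup>2 + c2 * (N / \<epsilon> powr (2 / 3))\<rceil> + 1"
  shows "36 * D\<^sup>2 \<le> \<epsilon>\<^sup>2 * real T"
    and "9 * (8 * H\<^sup>2 + G\<^sup>2) * (2 * real N / real T) ^ 3 \<le> \<epsilon>\<^sup>2"
    and "G * (L\<^sup>2 + \<Lambda>\<^sup>2) / (2 * \<Lambda> * sqrt (real T)) \<le> \<epsilon> / 4"
    and "\<epsilon> \<le> 1 \<Longrightarrow> real (T - 1 + N + T) \<le> (2 * c1 + 2 * c2 + 3) * (1 / \<epsilon>\<^sup>2 + N / \<epsilon> powr (2 / 3))"
proof -
  define M where "M = 9 * (8 * H\<^sup>2 + G\<^sup>2)"
  define p where "p = \<epsilon> powr (2 / 3)"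
  have M: "0 \<le> M" by (simp add: M_def)
  have c: "0 \<le> c1" "c2 = 2 * (M + 1)" by (simp_all add: c1_def c2_def M_def)
  then have c2: "0 < c2" using M by simp
  have p: "0 < p" using \<epsilon> by (simp add: p_def)
  have p3: "p ^ 3 = \<epsilon>\<^sup>2"
    using \<epsilon> by (simp add: p_def powr_power powr_numeral)
  let ?B = "c1 / \<epsilon>\<^sup>2 + c2 * (N / p)"
  have B: "0 \<le> c1 / \<epsilon>\<^sup>2" "0 \<le> c2 * (N / p)" using c c2 p by auto
  have T: "?B \<le> real T" "real T \<le> ?B + 2" "1 \<le> T"
    using B unfolding T_def p_def [symmetric] by linarith+
  have "c1 / \<epsilon>\<^sup>2 \<le> real T" using T B by linarith
  then have c1: "c1 \<le> \<epsilon>\<^sup>2 * real T"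
    using \<epsilon> by (simp add: field_simps)
  then show "36 * D\<^sup>2 \<le> \<epsilon>\<^sup>2 * real T"
    by (simp add: c1_def) (smt (verit) zero_le_power2)
  have "c2 * (N / p) \<le> real T" using T B by linarith
  \<comment> \<open>\<open>c2\<close> contains \<open>M + 1\<close> instead of \<open>M\<close>: it
    is positive even for \<open>M = 0\<close>, and \<open>M \<le> (M + 1) ^ 3\<close> will cancel
    the coefficient.\<close>
  then have "2 * real N / real T \<le> p / (M + 1)"
    using p T(3) M unfolding c(2) by (simp add: field_simps)
  then have "(2 * real N / real T) ^ 3 \<le> (p / (M + 1)) ^ 3"
    by (intro power_mono) auto
  then have "M * (2 * real N / real T) ^ 3 \<le> M * (p / (M + 1)) ^ 3"
    using M by (intro mult_left_mono)
  also have "\<dots> = \<epsilon>\<^sup>2 * (M / (M + 1) ^ 3)" by (simp add: power_divide p3)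
  also have "\<dots> \<le> \<epsilon>\<^sup>2"
  proof -
    have "M \<le> (M + 1) ^ 3" using M self_le_power [of "M + 1" 3] by simp
    then have "M / (M + 1) ^ 3 \<le> 1" using M by (simp add: divide_le_eq)
    then show ?thesis using M by (intro mult_right_le_one_le) auto
  qed
  finally show "9 * (8 * H\<^sup>2 + G\<^sup>2) * (2 * real N / real T) ^ 3 \<le> \<epsilon>\<^sup>2" by (simp add: M_def)
  define s where "s = 2 * G * (L\<^sup>2 + \<Lambda>\<^sup>2) / \<Lambda>"
  have s: "s\<^sup>2 \<le> c1" unfolding c1_def s_def by (rule add_increasing) simp_all
  have "s\<^sup>2 \<le> (\<epsilon> * sqrt (real T))\<^sup>2"
    unfolding power_mult_distrib using order_trans [OF s c1] by simp
  then have "s \<le> \<epsilon> * sqrt (real T)"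
    by (rule power2_le_imp_le) (use \<epsilon> in simp)
  then have "s / (4 * sqrt (real T)) \<le> \<epsilon> * sqrt (real T) / (4 * sqrt (real T))"
    by (intro divide_right_mono) auto
  then show "G * (L\<^sup>2 + \<Lambda>\<^sup>2) / (2 * \<Lambda> * sqrt (real T)) \<le> \<epsilon> / 4"
    using T(3) by (simp add: s_def)
  show "real (T - 1 + N + T) \<le> (2 * c1 + 2 * c2 + 3) * (1 / \<epsilon>\<^sup>2 + N / \<epsilon> powr (2 / 3))"
    if "\<epsilon> \<le> 1"
  proof -
    define u where "u = 1 / \<epsilon>\<^sup>2"
    define w where "w = N / p"
    have "1 \<le> u" using \<epsilon> that by (simp add: u_def power_le_one)
    have "p \<le> 1" unfolding p_def using \<epsilon> that by (simp add: powr_le1)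
    then have w: "real N \<le> w" using p by (simp add: w_def le_divide_eq mult_left_le)
    \<comment> \<open>Each of the two \<open>T\<close> is at most \<open>?B + 2\<close>, and the
      full step replaces one call by \<open>N\<close>, hence the constant
      \<open>2 * 2 - 1 = 3\<close>.\<close>
    have "real (T - 1 + N + T) \<le> 2 * (c1 * u + c2 * w) + 3 + real N"
      using T by (simp add: u_def w_def of_nat_diff)
    also have "\<dots> \<le> 2 * (c1 * u + c2 * w) + 3 * u + w"
      using \<open>1 \<le> u\<close> w by simp
    also have "\<dots> \<le> (2 * c1 + 2 * c2 + 3) * (u + w)"
    proof -
      have "0 \<le> c1 * w" "0 \<le> c2 * u" using c(1) c2 \<open>1 \<le> u\<close> w by auto
      then show ?thesis using \<open>1 \<le> u\<close> w by (simp add: distrib_left distrib_right)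
    qed
    finally show ?thesis by (simp add: u_def w_def p_def)
  qed
qed

section \<open>Nonconvexity as a Jensen gap\<close>

text \<open>The definition indexes combinations by an initial segment of the naturals; a bijection
  carries it over to the finite index sets \<open>Q\<^sub>i\<close>.\<close>

lemma jensen_gap_le_nonconvexity:
  fixes x :: "nat \<Rightarrow> fvec"
  assumes "finite Q" "\<And>l. l \<in> Q \<Longrightarrow> x l \<in> edom d f" "\<And>l. l \<in> Q \<Longrightarrow> 0 \<le> w l" "(\<Sum>l\<in>Q. w l) = 1"
  shows "f (\<Sum>l\<in>Q. w l *\<^sub>R x l) - (\<Sum>l\<in>Q. ereal (w l) * f (x l)) \<le> nonconvexity d f"
proof -
  obtain h where h: "bij_betw h {..<card Q} Q"
    using ex_bij_betw_nat_finite [OF assms(1)] by (auto simp: atLeast0LessThan)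
  have "f (\<Sum>j<card Q. w (h j) *\<^sub>R x (h j)) - (\<Sum>j<card Q. ereal (w (h j)) * f (x (h j)))
      \<le> nonconvexity d f"
    unfolding nonconvexity_def
  proof (rule Sup_upper, rule CollectI, intro exI conjI)
    show "\<forall>j<card Q. x (h j) \<in> edom d f \<and> 0 \<le> w (h j)"
      using assms bij_betwE [OF h] by auto
    show "(\<Sum>j<card Q. w (h j)) = 1"
      using assms(4) sum.reindex_bij_betw [OF h, of w] by simp
  qed (rule refl)
  then show ?thesis
    using sum.reindex_bij_betw [OF h, of "\<lambda>l. w l *\<^sub>R x l"]
      sum.reindex_bij_betw [OF h, of "\<lambda>l. ereal (w l) * f (x l)"] by simp
qed

section \<open>The dual problem and the oracle\<close>

locale two_stage =
  fixes P :: separable and lamstar :: fvec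
    and orc :: "nat \<Rightarrow> real \<times> fvec \<Rightarrow> fvec" and x0 :: "nat \<Rightarrow> fvec"
  assumes problem: "separable_problem P"
    and Hsup_finite: "Hsup P < \<infinity>"
    and duality: "strong_duality P lamstar"
    and orc_min: "is_oracle P orc"
    and start: "\<And>i. i \<in> idx P \<Longrightarrow> x0 i \<in> domf P i \<and> obj P i (x0 i) = fbb P i (x0 i)"
begin

abbreviation "N \<equiv> real (blocks P)"
abbreviation "m \<equiv> ncons P"
abbreviation "b \<equiv> rhs P"
abbreviation "G \<equiv> Gtilde P"
abbreviation "H \<equiv> real_of_ereal (Hsup P)"
abbreviation "D \<equiv> Dconst P"
abbreviation "dstar \<equiv> dval P lamstar"

text \<open>Real form of the biconjugate, faithful on \<open>Xset P i\<close> because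
  \<open>Hsup P\<close> is finite.\<close>

definition fb :: "nat \<Rightarrow> fvec \<Rightarrow> real" where
  "fb i x = real_of_ereal (fbb P i x)"

lemma N_ge_1: "1 \<le> N"
  using problem by (simp add: separable_problem_def)

lemma b_Rn: "b \<in> Rn m"
  using problem by (simp add: separable_problem_def)

lemma finite_idx [simp]: "finite (idx P)"
  and card_idx [simp]: "card (idx P) = blocks P"
  by (simp_all add: idx_def)

lemma idx_nonempty: "idx P \<noteq> {}"
  using N_ge_1 by (auto simp: idx_def)

lemma mean_le:
  assumes "\<And>i. i \<in> idx P \<Longrightarrow> f i \<le> (c :: real)"
  shows "(1 / N) * (\<Sum>i\<in>idx P. f i) \<le> c"
  using sum_bounded_above [of "idx P" f c] assms N_ge_1 by (simp add: field_simps)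

lemma mean_ge:
  assumes "\<And>i. i \<in> idx P \<Longrightarrow> (c :: real) \<le> f i"
  shows "c \<le> (1 / N) * (\<Sum>i\<in>idx P. f i)"
  using sum_bounded_below [of "idx P" c f] assms N_ge_1 by (simp add: field_simps)

lemma domf_subset_Xset: "domf P i \<subseteq> Xset P i"
  unfolding Xset_def by (rule hull_subset)

lemma Aop_Rn: "Aop P i x \<in> Rn m"
  unfolding Aop_def by (rule mat_vec_Rn)

lemma linear_Aop: "linear (Aop P i)"
  unfolding Aop_def by (rule linear_mat_vec)

lemma bounded_Xset: "i \<in> idx P \<Longrightarrow> bounded (Xset P i)"
  using problem unfolding Xset_def separable_problem_def
  by (auto intro: bounded_convex_hull compact_imp_bounded)

lemma bounded_Aop_image: "i \<in> idx P \<Longrightarrow> bounded (Aop P i ` Xset P i)"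
  unfolding Aop_def by (intro bounded_mat_vec_image bounded_Xset)

lemma abs_fbb_le: "i \<in> idx P \<Longrightarrow> x \<in> Xset P i \<Longrightarrow> \<bar>fbb P i x\<bar> \<le> Hsup P"
  unfolding Hsup_def by (intro Sup_upper) blast

lemma
  assumes "i \<in> idx P" "x \<in> Xset P i"
  shows fbb_eq: "fbb P i x = ereal (fb i x)" and abs_fb_le: "\<bar>fb i x\<bar> \<le> H"
  using abs_fbb_le [OF assms] Hsup_finite unfolding fb_def
  by (cases "fbb P i x"; cases "Hsup P"; simp)+

text \<open>The supremum in \<open>Gtilde\<close> is a real one, so it dominates its members only
  once they are known to be bounded above; compact domains provide this.\<close>

lemma norm_Aop_diff_le:
  assumes "i \<in> idx P" "x \<in> Xset P i"
  shows "norm (Aop P i x - b) \<le> G"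
proof -
  let ?S = "{norm (Aop P i x - b) | i x. i \<in> idx P \<and> x \<in> Xset P i}"
  have "bounded (\<Union>i\<in>idx P. Aop P i ` Xset P i)"
    by (intro bounded_Union) (auto intro: bounded_Aop_image)
  then obtain B where "\<And>y. y \<in> (\<Union>i\<in>idx P. Aop P i ` Xset P i) \<Longrightarrow> norm y \<le> B"
    by (auto simp: bounded_iff)
  then have "norm (Aop P i x - b) \<le> B + norm b" if "i \<in> idx P" "x \<in> Xset P i" for i x
    using that by (intro order_trans [OF norm_triangle_ineq4] add_right_mono) auto
  then have "bdd_above ?S" by (auto intro!: bdd_aboveI [of _ "B + norm b"])
  then show ?thesis unfolding Gtilde_def
    using assms by (intro cSup_upper) auto
qed

lemma norm_mean_Aop_diff_le:
  assumes "\<And>i. i \<in> idx P \<Longrightarrow> x i \<in> Xset P i"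
  shows "norm ((1 / N) *\<^sub>R (\<Sum>i\<in>idx P. Aop P i (x i)) - b) \<le> G"
proof -
  have "(1 / N) *\<^sub>R (\<Sum>i\<in>idx P. Aop P i (x i)) - b = (1 / N) *\<^sub>R (\<Sum>i\<in>idx P. Aop P i (x i) - b)"
    using N_ge_1
    by (simp add: sum_subtractf scaleR_diff_right sum_constant_scaleR)
  then have "norm ((1 / N) *\<^sub>R (\<Sum>i\<in>idx P. Aop P i (x i)) - b)
      \<le> (1 / N) * (\<Sum>i\<in>idx P. norm (Aop P i (x i) - b))"
    using N_ge_1 by (auto intro!: divide_right_mono sum_norm_le)
  also have "\<dots> \<le> G"
    by (intro mean_le norm_Aop_diff_le assms)
  finally show ?thesis .
qed

lemma G_nonneg: "0 \<le> G"
  using norm_mean_Aop_diff_le [of x0] start domf_subset_Xset norm_ge_zero order_trans by blast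

lemma
  assumes "i \<in> idx P" "0 \<le> \<gamma>" "lam \<in> Rn m"
  shows orc_Xset: "orc i (\<gamma>, lam) \<in> Xset P i"
    and orc_domf: "orc i (\<gamma>, lam) \<in> domf P i"
    and fval_orc: "fval P i (orc i (\<gamma>, lam)) = fb i (orc i (\<gamma>, lam))"
    and orc_le: "x \<in> Xset P i \<Longrightarrow> \<gamma> * fb i (orc i (\<gamma>, lam)) + inner lam (Aop P i (orc i (\<gamma>, lam)))
                  \<le> \<gamma> * fb i x + inner lam (Aop P i x)"
proof -
  let ?o = "orc i (\<gamma>, lam)"
  have *: "is_arg_min (\<lambda>x. ereal \<gamma> * fbb P i x + ereal (inner lam (Aop P i x)))
      (\<lambda>x. x \<in> Xset P i) ?o" "?o \<in> domf P i" "obj P i ?o = fbb P i ?o"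
    using orc_min assms unfolding is_oracle_def by auto
  then show o: "?o \<in> Xset P i" by (simp add: is_arg_min_linorder)
  show "?o \<in> domf P i" by fact
  show "fval P i ?o = fb i ?o" using * by (simp add: fval_def fb_def)
  show "\<gamma> * fb i ?o + inner lam (Aop P i ?o) \<le> \<gamma> * fb i x + inner lam (Aop P i x)"
    if x: "x \<in> Xset P i"
  proof -
    have "ereal \<gamma> * fbb P i ?o + ereal (inner lam (Aop P i ?o))
        \<le> ereal \<gamma> * fbb P i x + ereal (inner lam (Aop P i x))"
      using *(1) x by (simp add: is_arg_min_linorder)
    then show ?thesis by (simp add: fbb_eq [OF assms(1) x] fbb_eq [OF assms(1) o])
  qed
qed

section \<open>The dual function, its supergradients and strong duality\<close>

definition gbar :: "fvec \<Rightarrow> fvec" where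
  "gbar lam = (1 / N) *\<^sub>R (\<Sum>i\<in>idx P. Aop P i (orc i (1, lam))) - b"

lemma
  assumes lam: "lam \<in> Rn m"
  shows dual_eq: "dual P lam = ereal (dval P lam)"
    and dval_eq: "dval P lam = - inner lam b +
      (1 / N) * (\<Sum>i\<in>idx P. fb i (orc i (1, lam)) + inner lam (Aop P i (orc i (1, lam))))"
proof -
  let ?o = "\<lambda>i. orc i (1, lam)"
  have inf: "(INF x\<in>Xset P i. fbb P i x + ereal (inner lam (Aop P i x)))
      = ereal (fb i (?o i) + inner lam (Aop P i (?o i)))" if i: "i \<in> idx P" for i
  proof (rule antisym)
    show "(INF x\<in>Xset P i. fbb P i x + ereal (inner lam (Aop P i x)))
        \<le> ereal (fb i (?o i) + inner lam (Aop P i (?o i)))"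
      using orc_Xset [OF i _ lam, of 1] by (intro INF_lower2 [of "?o i"]) (simp_all add: fbb_eq i)
    show "ereal (fb i (?o i) + inner lam (Aop P i (?o i)))
        \<le> (INF x\<in>Xset P i. fbb P i x + ereal (inner lam (Aop P i x)))"
      using orc_le [OF i _ lam, of 1] by (intro INF_greatest) (simp add: fbb_eq i)
  qed
  have *: "dual P lam = ereal (- inner lam b +
      (1 / N) * (\<Sum>i\<in>idx P. fb i (?o i) + inner lam (Aop P i (?o i))))"
    unfolding dual_def by (simp add: inf)
  then show "dval P lam = - inner lam b + (1 / N) * (\<Sum>i\<in>idx P. fb i (?o i) + inner lam (Aop P i (?o i)))"
    by (simp add: dval_def)
  with * show "dual P lam = ereal (dval P lam)" by simp
qed

text \<open>The dual is an infimum of affine functions; the one given by the oracle answers at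
  \<open>lam\<close> touches it there and has slope \<open>gbar lam\<close>.\<close>

lemma dval_le_supergradient:
  assumes lam: "lam \<in> Rn m" and mu: "mu \<in> Rn m"
  shows "dval P mu \<le> dval P lam + inner (mu - lam) (gbar lam)"
proof -
  let ?o = "\<lambda>i. orc i (1, lam)"
  have "(\<Sum>i\<in>idx P. fb i (orc i (1, mu)) + inner mu (Aop P i (orc i (1, mu))))
      \<le> (\<Sum>i\<in>idx P. fb i (?o i) + inner mu (Aop P i (?o i)))"
    using orc_le [OF _ _ mu, of _ 1] orc_Xset [OF _ _ lam, of _ 1] by (intro sum_mono) simp
  then have "dval P mu \<le> - inner mu b + (1 / N) * (\<Sum>i\<in>idx P. fb i (?o i) + inner mu (Aop P i (?o i)))"
    unfolding dval_eq [OF mu] using N_ge_1 by (simp add: divide_right_mono)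
  also have "\<dots> = dval P lam + inner (mu - lam) (gbar lam)"
    unfolding dval_eq [OF lam] gbar_def
    by (simp add: sum.distrib inner_diff_left inner_diff_right inner_sum_right distrib_left
        sum_subtractf right_diff_distrib add_divide_distrib diff_divide_distrib)
  finally show ?thesis .
qed

lemma lamstar_orthant: "lamstar \<in> orthant m"
  using duality by (simp add: strong_duality_def)

lemma orthant_Rn: "lam \<in> orthant m \<Longrightarrow> lam \<in> Rn m"
  by (simp add: orthant_def)

lemma dval_le_dstar: "lam \<in> orthant m \<Longrightarrow> dval P lam \<le> dstar"
  using duality lamstar_orthant by (auto simp: strong_duality_def dual_eq orthant_Rn)

text \<open>Strong duality makes \<open>dstar\<close> an infimum over the bidual; nearly optimal
  points suffice, so no minimiser has to be produced.\<close>

lemma near_optimal: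
  assumes "0 < e"
  obtains x where "x \<in> bidual_feasible P" "(1 / N) * (\<Sum>i\<in>idx P. fb i (x i)) < dstar + e"
proof -
  have "bidual_value P = ereal dstar"
    using duality dual_eq [OF orthant_Rn [OF lamstar_orthant]] by (simp add: strong_duality_def)
  then have "bidual_value P < ereal (dstar + e)" using assms by simp
  then obtain x where x: "x \<in> bidual_feasible P"
    and lt: "ereal (1 / N) * (\<Sum>i\<in>idx P. fbb P i (x i)) < ereal (dstar + e)"
    unfolding bidual_value_def INF_less_iff by blast
  have "(\<Sum>i\<in>idx P. fbb P i (x i)) = (\<Sum>i\<in>idx P. ereal (fb i (x i)))"
    using x by (intro sum.cong fbb_eq) (auto simp: bidual_feasible_def)
  with lt have "(1 / N) * (\<Sum>i\<in>idx P. fb i (x i)) < dstar + e" by simp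
  with x that show ?thesis by blast
qed

text \<open>Keeps the objective part of the initial stage 2 residual within \<open>2 * H\<close>
  plus the dual gap.\<close>

lemma dstar_ge: "- H \<le> dstar"
proof (rule field_le_epsilon)
  fix e :: real assume "0 < e"
  then obtain x where x: "x \<in> bidual_feasible P" "(1 / N) * (\<Sum>i\<in>idx P. fb i (x i)) < dstar + e"
    using near_optimal by blast
  have "- H \<le> (1 / N) * (\<Sum>i\<in>idx P. fb i (x i))"
    using x(1) abs_fb_le by (intro mean_ge) (force simp: bidual_feasible_def)
  with x(2) show "- H \<le> dstar + e" by simp
qed

text \<open>By blockwise minimality the oracle answers do as well as any bidual feasible point. A
  nearly optimal one yields \<open>dstar\<close>, and \<open>lam\<close> being nonnegative turns its
  feasibility into \<open>inner lam b\<close>.\<close>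

lemma oracle_mean_le:
  assumes \<gamma>: "0 \<le> \<gamma>" and lam: "lam \<in> orthant m"
  shows "(1 / N) * (\<Sum>i\<in>idx P. \<gamma> * fb i (orc i (\<gamma>, lam)) + inner lam (Aop P i (orc i (\<gamma>, lam))))
    \<le> \<gamma> * dstar + inner lam b" (is "?L \<le> _")
proof (rule field_le_epsilon)
  fix e :: real assume e: "0 < e"
  \<comment> \<open>Dividing by \<open>\<gamma> + 1\<close> keeps the tolerance meaningful for
    \<open>\<gamma> = 0\<close> and at most \<open>e\<close> after multiplication by
    \<open>\<gamma>\<close>.\<close>
  then have "0 < e / (\<gamma> + 1)" using \<gamma> by simp
  then obtain x where x: "x \<in> bidual_feasible P"
    and lt: "(1 / N) * (\<Sum>i\<in>idx P. fb i (x i)) < dstar + e / (\<gamma> + 1)"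
    using near_optimal by blast
  have "?L \<le> (1 / N) * (\<Sum>i\<in>idx P. \<gamma> * fb i (x i) + inner lam (Aop P i (x i)))"
    using x \<gamma> lam orthant_Rn N_ge_1
    by (intro mult_left_mono sum_mono orc_le) (auto simp: bidual_feasible_def)
  also have "\<dots> = \<gamma> * ((1 / N) * (\<Sum>i\<in>idx P. fb i (x i)))
      + inner lam ((1 / N) *\<^sub>R (\<Sum>i\<in>idx P. Aop P i (x i)))"
    by (simp add: sum.distrib sum_distrib_left inner_sum_right add_divide_distrib sum_divide_distrib)
  also have "\<dots> \<le> \<gamma> * (dstar + e / (\<gamma> + 1)) + inner lam b"
  proof (intro add_mono mult_left_mono)
    show "inner lam ((1 / N) *\<^sub>R (\<Sum>i\<in>idx P. Aop P i (x i))) \<le> inner lam b"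
      unfolding inner_Rn [OF orthant_Rn [OF lam]]
      using x lam by (intro sum_mono mult_left_mono) (auto simp: bidual_feasible_def orthant_def)
  qed (use lt \<gamma> in auto)
  also have "\<gamma> * (dstar + e / (\<gamma> + 1)) \<le> \<gamma> * dstar + e"
    using \<gamma> e by (simp add: field_simps)
  finally show "?L \<le> \<gamma> * dstar + inner lam b + e" by simp
qed

section \<open>Stage 1\<close>

abbreviation draws :: "nat \<Rightarrow> (nat \<Rightarrow> nat) pmf" where
  "draws n \<equiv> Pi_pmf {..<n} 0 (\<lambda>_. pmf_of_set (idx P))"

lemma finite_draws: "finite (set_pmf (draws n))"
  using idx_nonempty by (intro finite_set_Pi_pmf) auto

text \<open>Used in both stages to average over the block drawn at iteration
  \<open>k\<close>.\<close>

lemma expectation_draws_resample: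
  fixes g :: "(nat \<Rightarrow> nat) \<Rightarrow> real"
  assumes "k < n"
  shows "measure_pmf.expectation (draws n) g =
    measure_pmf.expectation (draws n) (\<lambda>js. (1 / N) * (\<Sum>i\<in>idx P. g (js(k := i))))"
  using expectation_Pi_pmf_resample [of "{..<n}" k "idx P" 0 g] assms idx_nonempty by simp

lemma integrable_draws [simp]: "integrable (measure_pmf (draws n)) (f :: _ \<Rightarrow> real)"
  by (intro integrable_measure_pmf_finite finite_draws)

lemma sg_dir_Rn: "sg_dir P orc T js t lam \<in> Rn m"
  unfolding sg_dir_def by (auto intro!: Rn_diff Rn_scaleR Rn_sum Aop_Rn b_Rn)

lemma sg_iter_orthant: "sg_iter P orc \<alpha> 0 T js t \<in> orthant m"
proof (induction t)
  case 0
  then show ?case by (simp add: orthant_def)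
next
  case (Suc t)
  then show ?case
    by (simp add: proj_plus_orthant Rn_add Rn_scaleR sg_dir_Rn orthant_Rn)
qed

lemma sg_avg_orthant: "sg_avg P orc \<alpha> 0 T js \<in> orthant m"
  using sg_iter_orthant unfolding sg_avg_def orthant_def
  by (auto intro!: Rn_scaleR Rn_sum divide_nonneg_nonneg sum_nonneg)

text \<open>Multiplier \<open>t\<close> depends only on earlier draws, so it survives a redraw of
  block \<open>t\<close>.\<close>

lemma sg_iter_cong:
  "(\<And>s. s < t \<Longrightarrow> js s = js' s) \<Longrightarrow> sg_iter P orc \<alpha> lam0 T js t = sg_iter P orc \<alpha> lam0 T js' t"
  by (induction t) (simp_all add: sg_dir_def)

lemma gbar_inner_le:
  "lam \<in> orthant m \<Longrightarrow> inner (gbar lam) (lam - lamstar) \<le> dval P lam - dstar"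
  using dval_le_supergradient [of lam lamstar] lamstar_orthant
  by (simp add: orthant_Rn inner_commute inner_diff_left inner_diff_right)

lemma norm_gbar_le: "lam \<in> Rn m \<Longrightarrow> norm (gbar lam) \<le> G"
  unfolding gbar_def by (intro norm_mean_Aop_diff_le orc_Xset) auto

text \<open>Projecting does not increase the distance to \<open>lamstar\<close>, a point of the
  orthant; the rest is the expanded square.\<close>

lemma projected_step:
  assumes "lam \<in> orthant m" "g \<in> Rn m" "norm g \<le> G" "0 \<le> a"
  shows "(norm (proj_plus (lam + a *\<^sub>R g) - lamstar))\<^sup>2
    \<le> (norm (lam - lamstar))\<^sup>2 + 2 * a * inner g (lam - lamstar) + a\<^sup>2 * G\<^sup>2"
proof -
  have "(norm (proj_plus (lam + a *\<^sub>R g) - lamstar))\<^sup>2 \<le> (norm (lam + a *\<^sub>R g - lamstar))\<^sup>2"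
    using assms lamstar_orthant
    by (intro power_mono norm_proj_plus_diff_le [of _ m]) (auto intro: Rn_add Rn_scaleR orthant_Rn)
  also have "\<dots> = (norm (lam - lamstar))\<^sup>2 + 2 * a * inner g (lam - lamstar) + a\<^sup>2 * (norm g)\<^sup>2"
    unfolding power2_norm_eq_inner
    by (simp add: inner_add_left inner_add_right inner_diff_left inner_diff_right inner_commute
        algebra_simps power2_eq_square)
  also have "a\<^sup>2 * (norm g)\<^sup>2 \<le> a\<^sup>2 * G\<^sup>2"
    using assms by (intro mult_left_mono power_mono) auto
  finally show ?thesis by simp
qed

text \<open>Averaging over the block drawn at \<open>t\<close> turns the random direction into
  \<open>gbar\<close>, whose inner product with the error is controlled by the dual gap.\<close>

lemma sg_expected_step:
  fixes a :: real and T :: nat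
  assumes t: "t < T" and a: "0 \<le> a"
  defines "lam \<equiv> sg_iter P orc (\<lambda>_. a) 0 T"
  shows "measure_pmf.expectation (draws (T - 1)) (\<lambda>js. (norm (lam js (Suc t) - lamstar))\<^sup>2)
    \<le> measure_pmf.expectation (draws (T - 1)) (\<lambda>js. (norm (lam js t - lamstar))\<^sup>2)
      - 2 * a * measure_pmf.expectation (draws (T - 1)) (\<lambda>js. dstar - dval P (lam js t))
      + a\<^sup>2 * G\<^sup>2"
proof -
  let ?E = "\<lambda>f :: (nat \<Rightarrow> nat) \<Rightarrow> real. measure_pmf.expectation (draws (T - 1)) f"
  let ?B = "\<lambda>js. (norm (lam js t - lamstar))\<^sup>2 - 2 * a * (dstar - dval P (lam js t)) + a\<^sup>2 * G\<^sup>2"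
  have orth: "lam js t \<in> orthant m" for js
    unfolding lam_def by (rule sg_iter_orthant)
  have gbar: "2 * a * inner (gbar (lam js t)) (lam js t - lamstar)
      \<le> - 2 * a * (dstar - dval P (lam js t))" for js
    using mult_left_mono [OF gbar_inner_le [OF orth [of js]], of "2 * a"] a
    by (simp add: algebra_simps)
  have "?E (\<lambda>js. (norm (lam js (Suc t) - lamstar))\<^sup>2) \<le> ?E ?B"
  proof (cases "t + 1 < T")
    \<comment> \<open>The last step draws no block: its direction is \<open>gbar\<close> on every
      path.\<close>
    case False
    show ?thesis
    proof (intro expectation_pmf_mono finite_draws)
      fix js
      have "(norm (lam js (Suc t) - lamstar))\<^sup>2
          = (norm (proj_plus (lam js t + a *\<^sub>R gbar (lam js t)) - lamstar))\<^sup>2"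
        using False by (simp add: lam_def sg_dir_def gbar_def)
      also have "\<dots> \<le> (norm (lam js t - lamstar))\<^sup>2
          + 2 * a * inner (gbar (lam js t)) (lam js t - lamstar) + a\<^sup>2 * G\<^sup>2"
        using a orth norm_gbar_le orthant_Rn
        by (intro projected_step) (auto simp: gbar_def intro!: Rn_diff Rn_scaleR Rn_sum Aop_Rn b_Rn)
      also have "\<dots> \<le> ?B js" using gbar [of js] by simp
      finally show "(norm (lam js (Suc t) - lamstar))\<^sup>2 \<le> ?B js" .
    qed
  next
    case True
    have "?E (\<lambda>js. (norm (lam js (Suc t) - lamstar))\<^sup>2)
        = ?E (\<lambda>js. (1 / N) * (\<Sum>i\<in>idx P. (norm (lam (js(t := i)) (Suc t) - lamstar))\<^sup>2))"
      using True by (intro expectation_draws_resample) simp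
    also have "\<dots> \<le> ?E ?B"
    proof (intro expectation_pmf_mono finite_draws)
      fix js
      define g where "g i = Aop P i (orc i (1, lam js t)) - b" for i
      have unchanged: "lam (js(t := i)) t = lam js t" for i
        unfolding lam_def by (rule sg_iter_cong) simp
      have "(norm (lam (js(t := i)) (Suc t) - lamstar))\<^sup>2
          \<le> (norm (lam js t - lamstar))\<^sup>2 + 2 * a * inner (g i) (lam js t - lamstar) + a\<^sup>2 * G\<^sup>2"
        if "i \<in> idx P" for i
      proof -
        have "lam (js(t := i)) (Suc t) = proj_plus (lam js t + a *\<^sub>R g i)"
          using True unchanged [of i] by (simp add: lam_def sg_dir_def g_def)
        moreover have "norm (g i) \<le> G"
          unfolding g_def using that orth orthant_Rn by (intro norm_Aop_diff_le orc_Xset) auto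
        ultimately show ?thesis
          using projected_step [OF orth, of "g i" a js] a
          by (simp add: g_def Rn_diff Aop_Rn b_Rn)
      qed
      then have "(1 / N) * (\<Sum>i\<in>idx P. (norm (lam (js(t := i)) (Suc t) - lamstar))\<^sup>2)
          \<le> (1 / N) * (\<Sum>i\<in>idx P. (norm (lam js t - lamstar))\<^sup>2
              + 2 * a * inner (g i) (lam js t - lamstar) + a\<^sup>2 * G\<^sup>2)"
        using N_ge_1 by (intro mult_left_mono sum_mono) auto
      also have "\<dots> = (norm (lam js t - lamstar))\<^sup>2
          + 2 * a * inner ((1 / N) *\<^sub>R (\<Sum>i\<in>idx P. g i)) (lam js t - lamstar) + a\<^sup>2 * G\<^sup>2"
        using N_ge_1
        by (simp add: sum.distrib inner_sum_left sum_distrib_left [symmetric] field_simps)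
      also have "(1 / N) *\<^sub>R (\<Sum>i\<in>idx P. g i) = gbar (lam js t)"
        using N_ge_1 by (simp add: g_def gbar_def sum_subtractf scaleR_diff_right sum_constant_scaleR)
      finally show "(1 / N) * (\<Sum>i\<in>idx P. (norm (lam (js(t := i)) (Suc t) - lamstar))\<^sup>2) \<le> ?B js"
        using gbar [of js] by linarith
    qed
    finally show ?thesis .
  qed
  then show ?thesis by simp
qed

text \<open>Jensen's inequality for the concave dual, via the supergradient at the average: the
  linear terms cancel in the sum.\<close>

lemma dual_gap_sg_avg_le:
  assumes "1 \<le> T"
  shows "dstar - dval P (sg_avg P orc \<alpha> 0 T js)
    \<le> (1 / real T) * (\<Sum>t<T. dstar - dval P (sg_iter P orc \<alpha> 0 T js t))"
proof -
  let ?l = "sg_iter P orc \<alpha> 0 T js" and ?a = "sg_avg P orc \<alpha> 0 T js"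
  have "(\<Sum>t<T. dval P (?l t)) \<le> (\<Sum>t<T. dval P ?a + inner (?l t - ?a) (gbar ?a))"
    by (intro sum_mono dval_le_supergradient orthant_Rn sg_iter_orthant sg_avg_orthant)
  also have "\<dots> = real T * dval P ?a + inner ((\<Sum>t<T. ?l t) - real T *\<^sub>R ?a) (gbar ?a)"
    by (simp add: sum.distrib inner_sum_left inner_diff_left sum_subtractf)
  also have "\<dots> = real T * dval P ?a"
    using assms by (simp add: sg_avg_def)
  finally show ?thesis
    using assms by (simp add: sum_subtractf field_simps)
qed

lemma expected_dual_gap_le:
  assumes T: "1 \<le> T" and \<Lambda>: "0 < \<Lambda>"
  shows "measure_pmf.expectation (draws (T - 1))
      (\<lambda>js. dstar - dval P (sg_avg P orc (\<lambda>t. \<Lambda> / (G * sqrt (real T))) 0 T js))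
    \<le> G * ((norm lamstar)\<^sup>2 + \<Lambda>\<^sup>2) / (2 * \<Lambda> * sqrt (real T))"
proof (cases "G = 0")
  let ?E = "\<lambda>f :: (nat \<Rightarrow> nat) \<Rightarrow> real. measure_pmf.expectation (draws (T - 1)) f"
  let ?avg = "sg_avg P orc (\<lambda>t. \<Lambda> / (G * sqrt (real T))) 0 T"
  case True
  txt \<open>The stepsize is \<open>\<Lambda> / 0 = 0\<close>, but every supergradient vanishes, so each multiplier is optimal.\<close>
  have "dstar - dval P (?avg js) \<le> 0" for js
  proof -
    have "?avg js \<in> orthant m" by (rule sg_avg_orthant)
    moreover from this have "gbar (?avg js) = 0" using norm_gbar_le True orthant_Rn by force
    ultimately show ?thesis using gbar_inner_le [of "?avg js"] by simp
  qed
  then have "?E (\<lambda>js. dstar - dval P (?avg js)) \<le> ?E (\<lambda>js. 0)"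
    by (intro expectation_pmf_mono finite_draws)
  with True show ?thesis by simp
next
  let ?E = "\<lambda>f :: (nat \<Rightarrow> nat) \<Rightarrow> real. measure_pmf.expectation (draws (T - 1)) f"
  let ?avg = "sg_avg P orc (\<lambda>t. \<Lambda> / (G * sqrt (real T))) 0 T"
  case False
  with G_nonneg have G: "0 < G" by simp
  define a where "a = \<Lambda> / (G * sqrt (real T))"
  define lam where "lam = sg_iter P orc (\<lambda>_. a) 0 T"
  let ?W = "\<lambda>t. ?E (\<lambda>js. (norm (lam js t - lamstar))\<^sup>2)"
  let ?gap = "\<lambda>t. ?E (\<lambda>js. dstar - dval P (lam js t))"
  have a: "0 < a" using G \<Lambda> T by (simp add: a_def)
  \<comment> \<open>The one-step inequality telescoped from the zero multiplier.\<close>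
  have W: "?W n \<le> (norm lamstar)\<^sup>2 - 2 * a * (\<Sum>t<n. ?gap t) + real n * (a\<^sup>2 * G\<^sup>2)" if "n \<le> T" for n
    using that
  proof (induction n)
    case 0
    then show ?case by (simp add: lam_def)
  next
    case (Suc n)
    then show ?case
      using sg_expected_step [of n T a] a by (simp add: lam_def algebra_simps)
  qed
  have "0 \<le> ?W T" by (rule integral_nonneg_AE) simp
  then have "2 * a * (\<Sum>t<T. ?gap t) \<le> (norm lamstar)\<^sup>2 + real T * (a\<^sup>2 * G\<^sup>2)"
    using W [OF order_refl] by linarith
  \<comment> \<open>The stepsize is scaled so that the accumulated squared steps equal
    \<open>\<Lambda>\<^sup>2\<close> whatever \<open>T\<close> is.\<close>
  also have "real T * (a\<^sup>2 * G\<^sup>2) = \<Lambda>\<^sup>2"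
    using G T by (simp add: a_def power_divide power_mult_distrib)
  finally have sum_gap: "2 * a * (\<Sum>t<T. ?gap t) \<le> (norm lamstar)\<^sup>2 + \<Lambda>\<^sup>2" .
  have "?E (\<lambda>js. dstar - dval P (?avg js)) \<le> ?E (\<lambda>js. (1 / real T) * (\<Sum>t<T. dstar - dval P (lam js t)))"
    unfolding lam_def a_def by (intro expectation_pmf_mono finite_draws dual_gap_sg_avg_le T)
  also have "\<dots> = (1 / real T) * (\<Sum>t<T. ?gap t)" by simp
  also have "\<dots> \<le> (1 / real T) * (((norm lamstar)\<^sup>2 + \<Lambda>\<^sup>2) / (2 * a))"
    using sum_gap a by (intro mult_left_mono) (auto simp: field_simps)
  also have "\<dots> = G * ((norm lamstar)\<^sup>2 + \<Lambda>\<^sup>2) / (2 * \<Lambda> * sqrt (real T))"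
  proof -
    have "real T * a = \<Lambda> * sqrt (real T) / G"
      using G T by (simp add: a_def field_simps)
    moreover have "(1 / real T) * (((norm lamstar)\<^sup>2 + \<Lambda>\<^sup>2) / (2 * a))
        = ((norm lamstar)\<^sup>2 + \<Lambda>\<^sup>2) / (2 * (real T * a))"
      by simp
    ultimately show ?thesis by (simp add: mult_ac)
  qed
  finally show ?thesis .
qed

section \<open>Stage 2\<close>

text \<open>Invariant of stage 2. A block carries the factor \<open>1 / N\<close>; rescaled, it lies
  in the convex hull whose diameter enters \<open>D\<close>.\<close>

definition valid_state :: "(nat \<Rightarrow> real \<times> fvec) \<Rightarrow> bool" where
  "valid_state s \<longleftrightarrow> (\<forall>i\<in>idx P. N *\<^sub>R s i \<in> convex hull (Cset P i))"

lemma atom_in_Cset: "x \<in> Xset P i \<Longrightarrow> (fb i x, Aop P i x) \<in> Cset P i"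
  by (auto simp: Cset_def fb_def)

lemma bounded_Cset:
  assumes i: "i \<in> idx P"
  shows "bounded (Cset P i)"
proof (rule bounded_subset)
  show "bounded ({- H..H} \<times> Aop P i ` Xset P i)"
    using i by (intro bounded_Times bounded_Aop_image) auto
  show "Cset P i \<subseteq> {- H..H} \<times> Aop P i ` Xset P i"
    using abs_fb_le [OF i] by (force simp: Cset_def fb_def [symmetric] abs_le_iff)
qed

lemma valid_Rn:
  assumes "valid_state s" "i \<in> idx P"
  shows "snd (s i) \<in> Rn m"
proof -
  have "convex (UNIV \<times> Rn m :: (real \<times> fvec) set)"
    by (auto simp: convex_def intro: Rn_add Rn_scaleR)
  then have "convex hull (Cset P i) \<subseteq> UNIV \<times> Rn m"
    by (intro hull_minimal) (auto simp: Cset_def Aop_Rn)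
  then have "N *\<^sub>R s i \<in> UNIV \<times> Rn m" using assms by (auto simp: valid_state_def)
  then have "N *\<^sub>R snd (s i) \<in> Rn m" by (metis mem_Times_iff snd_scaleR)
  then have "(1 / N) *\<^sub>R (N *\<^sub>R snd (s i)) \<in> Rn m" by (rule Rn_scaleR)
  then show ?thesis using N_ge_1 by simp
qed

text \<open>Makes the current direction an admissible oracle query.\<close>

lemma
  assumes "valid_state s"
  shows fw_dir_fst: "0 \<le> fst (fw_dir P v s)"
    and fw_dir_snd: "snd (fw_dir P v s) \<in> orthant m"
  using valid_Rn [OF assms] b_Rn
  by (auto simp: fw_dir_def intro!: proj_plus_orthant Rn_diff Rn_sum)

lemma fw_oracle:
  assumes "valid_state s" "i \<in> idx P"
  shows "orc i (fw_dir P v s) \<in> Xset P i" "orc i (fw_dir P v s) \<in> domf P i"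
    "fval P i (orc i (fw_dir P v s)) = fb i (orc i (fw_dir P v s))"
  using orc_Xset [OF assms(2) fw_dir_fst [OF assms(1), of v] orthant_Rn [OF fw_dir_snd [OF assms(1), of v]]]
    orc_domf [OF assms(2) fw_dir_fst [OF assms(1), of v] orthant_Rn [OF fw_dir_snd [OF assms(1), of v]]]
    fval_orc [OF assms(2) fw_dir_fst [OF assms(1), of v] orthant_Rn [OF fw_dir_snd [OF assms(1), of v]]]
  by simp_all

lemma fw_atom_in_hull:
  assumes "valid_state s" "i \<in> idx P"
  shows "(fval P i (orc i (fw_dir P v s)), Aop P i (orc i (fw_dir P v s))) \<in> convex hull (Cset P i)"
  using fw_oracle [OF assms] by (simp add: hull_inc atom_in_Cset)

lemma fw_step_bounds: "0 < fw_step P k" "fw_step P k \<le> 1"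
  using N_ge_1 by (auto simp: fw_step_def add_nonneg_pos)

lemma valid_fw_state: "valid_state (fw_state P orc x0 v js k)"
proof (induction k)
  case 0
  show ?case
    using start domf_subset_Xset N_ge_1 atom_in_Cset
    by (fastforce simp: valid_state_def fb_def [symmetric] intro!: hull_inc)
next
  case (Suc k)
  define s where "s = fw_state P orc x0 v js k"
  have s: "valid_state s" using Suc by (simp add: s_def)
  let ?\<rho> = "fw_step P k" and ?i = "js k"
  let ?c = "(fval P ?i (orc ?i (fw_dir P v s)), Aop P ?i (orc ?i (fw_dir P v s)))"
  \<comment> \<open>The draws are an arbitrary function here; if \<open>js k\<close> is no block
    index, no block of \<open>idx P\<close> changes.\<close>
  have "N *\<^sub>R ((1 - ?\<rho>) *\<^sub>R s ?i + (?\<rho> / N) *\<^sub>R ?c) \<in> convex hull (Cset P ?i)" if "?i \<in> idx P"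
  proof -
    have "(1 - ?\<rho>) *\<^sub>R (N *\<^sub>R s ?i) + ?\<rho> *\<^sub>R ?c \<in> convex hull (Cset P ?i)"
      using s that fw_atom_in_hull [OF s that] fw_step_bounds [of k]
      by (intro convexD [OF convex_convex_hull]) (auto simp: valid_state_def)
    moreover have "N *\<^sub>R ((1 - ?\<rho>) *\<^sub>R s ?i + (?\<rho> / N) *\<^sub>R ?c) = (1 - ?\<rho>) *\<^sub>R (N *\<^sub>R s ?i) + ?\<rho> *\<^sub>R ?c"
      using N_ge_1 by (simp only: scaleR_add_right scaleR_scaleR) (simp add: mult.commute)
    ultimately show ?thesis by simp
  qed
  then show ?case
    using s by (auto simp: valid_state_def Let_def s_def [symmetric])
qed

lemma D_power2: "D\<^sup>2 = (1 / N) * (\<Sum>i\<in>idx P. (diameter (convex hull (Cset P i)))\<^sup>2)"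
  by (simp add: Dconst_def sum_nonneg)

text \<open>
  The objective of stage 2 is half the squared distance to the cone of points below \<open>(v, b)\<close>, so the
  direction to a point of that cone decreases it to first order by twice its value; convexity alone
  would give once.  Up to the dual gap \<open>dstar - v\<close> this doubles the contraction rate.
\<close>

lemma fw_mean_step:
  fixes v \<rho> :: real
  assumes s: "valid_state s" and \<rho>: "0 \<le> \<rho>"
  defines "c \<equiv> \<lambda>i. (fval P i (orc i (fw_dir P v s)), Aop P i (orc i (fw_dir P v s)))"
  shows "(1 / N) * (\<Sum>i\<in>idx P. (norm (fw_dir P v (s(i := (1 - \<rho>) *\<^sub>R s i + (\<rho> / N) *\<^sub>R c i))))\<^sup>2)
    \<le> (norm (fw_dir P v s))\<^sup>2
      + 2 * (\<rho> / N) * (fst (fw_dir P v s) * (dstar - v) - (norm (fw_dir P v s))\<^sup>2)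
      + (\<rho> / N)\<^sup>2 * D\<^sup>2"
proof -
  define q where "q = fw_dir P v s"
  define y where "y = (\<Sum>i\<in>idx P. s i) - (v, b)"
  define e where "e i = (\<rho> / N) *\<^sub>R (c i - N *\<^sub>R s i)" for i
  have q: "q = pos_part y" by (simp add: q_def y_def fw_dir_eq_pos_part)
  have y_Rn: "snd y \<in> Rn m"
    unfolding y_def using valid_Rn [OF s] b_Rn by (auto simp: snd_sum intro!: Rn_diff Rn_sum)
  have step: "(norm (fw_dir P v (s(i := (1 - \<rho>) *\<^sub>R s i + (\<rho> / N) *\<^sub>R c i))))\<^sup>2
      \<le> (norm q)\<^sup>2 + 2 * (\<rho> / N) * (inner q (c i) - N * inner q (s i))
        + (\<rho> / N)\<^sup>2 * (diameter (convex hull (Cset P i)))\<^sup>2" if i: "i \<in> idx P" for i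
  proof -
    let ?s' = "s(i := (1 - \<rho>) *\<^sub>R s i + (\<rho> / N) *\<^sub>R c i)"
    have "(\<Sum>j\<in>idx P. ?s' j) = ?s' i + (\<Sum>j\<in>idx P - {i}. s j)"
      using i by (subst sum.remove [of _ i]) (auto intro!: sum.cong)
    also have "?s' i = s i + e i"
      using N_ge_1 by (simp add: e_def scaleR_diff_left scaleR_diff_right)
    also have "s i + e i + (\<Sum>j\<in>idx P - {i}. s j) = (\<Sum>j\<in>idx P. s j) + e i"
      using i by (subst (2) sum.remove [of _ i]) auto
    finally have "fw_dir P v ?s' = pos_part (y + e i)"
      by (simp add: fw_dir_eq_pos_part y_def algebra_simps)
    moreover have "snd (e i) \<in> Rn m"
      using valid_Rn [OF s i] by (simp add: e_def c_def Rn_diff Rn_scaleR Aop_Rn)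
    ultimately have "(norm (fw_dir P v ?s'))\<^sup>2 \<le> (norm q)\<^sup>2 + 2 * inner q (e i) + (norm (e i))\<^sup>2"
      using norm_pos_part_add_power2_le [OF y_Rn] by (simp add: q)
    moreover have "2 * inner q (e i) = 2 * (\<rho> / N) * (inner q (c i) - N * inner q (s i))"
      by (simp add: e_def inner_diff_right)
    \<comment> \<open>Both points lie in the convex hull of \<open>Cset P i\<close>; averaging the
      squared diameters over \<open>i\<close> produces \<open>D\<^sup>2\<close>.\<close>
    moreover have "norm (c i - N *\<^sub>R s i) \<le> diameter (convex hull (Cset P i))"
      unfolding dist_norm [symmetric] using s i fw_atom_in_hull [OF s i]
      by (intro diameter_bounded_bound bounded_convex_hull bounded_Cset) (auto simp: c_def valid_state_def)
    then have "(norm (e i))\<^sup>2 \<le> (\<rho> / N)\<^sup>2 * (diameter (convex hull (Cset P i)))\<^sup>2"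
      unfolding e_def norm_scaleR power_mult_distrib
      using \<rho> by (intro mult_mono power_mono) auto
    ultimately show ?thesis by linarith
  qed
  have "(1 / N) * (\<Sum>i\<in>idx P. (norm (fw_dir P v (s(i := (1 - \<rho>) *\<^sub>R s i + (\<rho> / N) *\<^sub>R c i))))\<^sup>2)
    \<le> (1 / N) * (\<Sum>i\<in>idx P. (norm q)\<^sup>2 + 2 * (\<rho> / N) * (inner q (c i) - N * inner q (s i))
        + (\<rho> / N)\<^sup>2 * (diameter (convex hull (Cset P i)))\<^sup>2)"
    using N_ge_1 step by (intro mult_left_mono sum_mono) auto
  also have "\<dots> = (norm q)\<^sup>2
      + 2 * (\<rho> / N) * ((1 / N) * (\<Sum>i\<in>idx P. inner q (c i)) - inner q (\<Sum>i\<in>idx P. s i))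
      + (\<rho> / N)\<^sup>2 * D\<^sup>2"
    unfolding D_power2 sum.distrib inner_sum_right distrib_left
      sum_distrib_left [symmetric] sum_subtractf
    using N_ge_1 by (simp add: field_simps)
  finally have mean: "(1 / N) * (\<Sum>i\<in>idx P. (norm (fw_dir P v (s(i := (1 - \<rho>) *\<^sub>R s i + (\<rho> / N) *\<^sub>R c i))))\<^sup>2)
      \<le> (norm q)\<^sup>2 + 2 * (\<rho> / N) * ((1 / N) * (\<Sum>i\<in>idx P. inner q (c i)) - inner q (\<Sum>i\<in>idx P. s i))
        + (\<rho> / N)\<^sup>2 * D\<^sup>2" .
  \<comment> \<open>The query is the residual direction \<open>q\<close> itself: the oracle bound
    contributes \<open>dstar\<close> and \<open>b\<close>, and \<open>inner_pos_part\<close> makes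
    \<open>inner q y\<close> the full square of \<open>norm q\<close>.\<close>
  have "(1 / N) * (\<Sum>i\<in>idx P. inner q (c i)) - inner q (\<Sum>i\<in>idx P. s i)
      \<le> fst q * (dstar - v) - (norm q)\<^sup>2"
  proof -
    have "(\<Sum>i\<in>idx P. inner q (c i))
        = (\<Sum>i\<in>idx P. fst q * fb i (orc i q) + inner (snd q) (Aop P i (orc i q)))"
      using fw_oracle(3) [OF s] by (intro sum.cong) (auto simp: c_def q_def inner_prod_def)
    then have "(1 / N) * (\<Sum>i\<in>idx P. inner q (c i)) \<le> fst q * dstar + inner (snd q) b"
      using oracle_mean_le [of "fst q" "snd q"] fw_dir_fst [OF s] fw_dir_snd [OF s]
      by (simp add: q_def)
    moreover have "inner q (\<Sum>i\<in>idx P. s i) = (norm q)\<^sup>2 + fst q * v + inner (snd q) b"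
    proof -
      have "inner q (\<Sum>i\<in>idx P. s i) = inner q y + inner q (v, b)"
        by (simp add: y_def inner_diff_right)
      then show ?thesis using inner_pos_part [OF y_Rn] by (simp add: q inner_prod_def)
    qed
    ultimately show ?thesis by (simp add: algebra_simps)
  qed
  then have "2 * (\<rho> / N) * ((1 / N) * (\<Sum>i\<in>idx P. inner q (c i)) - inner q (\<Sum>i\<in>idx P. s i))
      \<le> 2 * (\<rho> / N) * (fst q * (dstar - v) - (norm q)\<^sup>2)"
    using \<rho> by (intro mult_left_mono) auto
  with mean show ?thesis unfolding q_def by linarith
qed

lemma fw_state_cong:
  "(\<And>l. l < k \<Longrightarrow> js l = js' l) \<Longrightarrow> fw_state P orc x0 v js k = fw_state P orc x0 v js' k"
  by (induction k) simp_all

text \<open>\<open>v\<close> is held fixed; the draws of stage 1 are averaged later. As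
  \<open>fw_step P k / N = 2 / n\<close>, the first-order contraction is
  \<open>4 / n\<close>.\<close>

lemma fw_expected_step:
  fixes v :: real and k :: nat
  assumes k: "k < K"
  defines "n \<equiv> k + 2 * blocks P"
    and "V \<equiv> \<lambda>j js. (norm (fw_dir P v (fw_state P orc x0 v js j)))\<^sup>2"
  shows "measure_pmf.expectation (draws K) (V (Suc k))
    \<le> (1 - 3 / n) * measure_pmf.expectation (draws K) (V k) + 4 / n * (dstar - v)\<^sup>2 + 4 * D\<^sup>2 / n\<^sup>2"
proof -
  let ?E = "\<lambda>f :: (nat \<Rightarrow> nat) \<Rightarrow> real. measure_pmf.expectation (draws K) f"
  have "?E (V (Suc k)) = ?E (\<lambda>js. (1 / N) * (\<Sum>i\<in>idx P. V (Suc k) (js(k := i))))"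
    using k by (rule expectation_draws_resample)
  also have "\<dots> \<le> ?E (\<lambda>js. (1 - 3 / n) * V k js + (4 / n * (dstar - v)\<^sup>2 + 4 * D\<^sup>2 / n\<^sup>2))"
  proof (intro expectation_pmf_mono finite_draws)
    fix js
    define s where "s = fw_state P orc x0 v js k"
    define \<gamma> where "\<gamma> = fst (fw_dir P v s)"
    have s: "valid_state s" unfolding s_def by (rule valid_fw_state)
    have n: "0 < n" using N_ge_1 by (simp add: n_def)
    have \<rho>: "fw_step P k / N = 2 / n"
      using N_ge_1 by (simp add: fw_step_def n_def)
    have unchanged: "fw_state P orc x0 v (js(k := i)) k = s" for i
      unfolding s_def by (rule fw_state_cong) simp
    have "fw_state P orc x0 v (js(k := i)) (Suc k)
        = s(i := (1 - fw_step P k) *\<^sub>R s i + (fw_step P k / N) *\<^sub>R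
            (fval P i (orc i (fw_dir P v s)), Aop P i (orc i (fw_dir P v s))))" for i
      using unchanged [of i] by (simp add: Let_def)
    then have "(1 / N) * (\<Sum>i\<in>idx P. V (Suc k) (js(k := i)))
        \<le> V k js + 2 * (2 / n) * (\<gamma> * (dstar - v) - V k js) + (2 / n)\<^sup>2 * D\<^sup>2"
      using fw_mean_step [OF s, of "fw_step P k" v] fw_step_bounds [of k]
      unfolding \<rho> V_def \<gamma>_def by (simp only: s_def [symmetric])
    \<comment> \<open>Young's inequality spends a quarter of the contraction on the dual gap, which
      leaves three quarters of \<open>4 / n\<close>.\<close>
    also have "2 * (2 / n) * (\<gamma> * (dstar - v) - V k js)
        \<le> 2 * (2 / n) * (V k js / 4 + (dstar - v)\<^sup>2 - V k js)"
    proof -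
      have "\<gamma>\<^sup>2 \<le> V k js"
        unfolding V_def \<gamma>_def s_def by (subst norm_prod_power2) simp
      moreover have "0 \<le> (\<gamma> / 2 - (dstar - v))\<^sup>2" by simp
      ultimately have "\<gamma> * (dstar - v) \<le> V k js / 4 + (dstar - v)\<^sup>2"
        by (simp add: power2_diff power_divide)
      then show ?thesis by (intro mult_left_mono diff_right_mono) auto
    qed
    also have "V k js + 2 * (2 / n) * (V k js / 4 + (dstar - v)\<^sup>2 - V k js) + (2 / n)\<^sup>2 * D\<^sup>2
        = (1 - 3 / n) * V k js + (4 / n * (dstar - v)\<^sup>2 + 4 * D\<^sup>2 / n\<^sup>2)"
      using n by (simp add: field_simps power2_eq_square)
    finally show "(1 / N) * (\<Sum>i\<in>idx P. V (Suc k) (js(k := i)))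
        \<le> (1 - 3 / n) * V k js + (4 / n * (dstar - v)\<^sup>2 + 4 * D\<^sup>2 / n\<^sup>2)"
      by simp
  qed
  finally show ?thesis by (simp add: add.assoc)
qed

section \<open>Unrolling the Frank-Wolfe recursion\<close>

lemma fw_initial_le: "(norm (fw_dir P v (fw_state P orc x0 v js 0)))\<^sup>2 \<le> 8 * H\<^sup>2 + G\<^sup>2 + 2 * (dstar - v)\<^sup>2"
proof -
  define \<beta> where "\<beta> = (1 / N) * (\<Sum>i\<in>idx P. fb i (x0 i))"
  define z where "z = (1 / N) *\<^sub>R (\<Sum>i\<in>idx P. Aop P i (x0 i)) - b"
  have x0: "x0 i \<in> Xset P i" if "i \<in> idx P" for i
    using start [OF that] domf_subset_Xset by blast
  have "fw_dir P v (fw_state P orc x0 v js 0) = (max (\<beta> - v) 0, proj_plus z)"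
    by (simp add: fw_dir_def \<beta>_def z_def fb_def sum_divide_distrib scaleR_sum_right)
  then have "(norm (fw_dir P v (fw_state P orc x0 v js 0)))\<^sup>2 = (max (\<beta> - v) 0)\<^sup>2 + (norm (proj_plus z))\<^sup>2"
    by (simp add: norm_prod_power2)
  also have "(norm (proj_plus z))\<^sup>2 \<le> G\<^sup>2"
  proof (rule power_mono)
    have "norm (proj_plus z) \<le> norm z"
      unfolding z_def by (intro norm_proj_plus_le [of _ m] Rn_diff Rn_scaleR Rn_sum Aop_Rn b_Rn)
    also have "\<dots> \<le> G" unfolding z_def by (intro norm_mean_Aop_diff_le x0)
    finally show "norm (proj_plus z) \<le> G" .
  qed simp
  also have "(max (\<beta> - v) 0)\<^sup>2 \<le> 8 * H\<^sup>2 + 2 * (dstar - v)\<^sup>2"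
  proof -
    have "\<beta> \<le> H" unfolding \<beta>_def using abs_fb_le x0 by (intro mean_le) (force simp: abs_le_iff)
    \<comment> \<open>Combines \<open>\<beta> \<le> H\<close> with \<open>- H \<le> dstar\<close>.
      The absolute value covers a negative right-hand side, as \<open>v\<close> is
      arbitrary.\<close>
    then have "max (\<beta> - v) 0 \<le> \<bar>2 * H + (dstar - v)\<bar>" using dstar_ge by auto
    then have "(max (\<beta> - v) 0)\<^sup>2 \<le> (2 * H + (dstar - v))\<^sup>2"
      using power_mono [of "max (\<beta> - v) 0" "\<bar>2 * H + (dstar - v)\<bar>" 2] by simp
    also have "(2 * H + d)\<^sup>2 \<le> 8 * H\<^sup>2 + 2 * d\<^sup>2" for d
      using zero_le_power2 [of "2 * H - d"] by (simp add: power2_sum power2_diff power_mult_distrib)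
    finally show ?thesis .
  qed
  finally show ?thesis by simp
qed

text \<open>Induction with \<open>residual_recursion\<close>, taking \<open>a = 2 * N\<close>,
  \<open>c = 4 * D\<^sup>2\<close> and for \<open>Y\<close> the bound of
  \<open>fw_initial_le\<close>; at step 0 the cubed ratio is 1, so the \<open>Y\<close> term alone
  covers the initial residual.\<close>

lemma fw_expected_residual_power2:
  fixes K :: nat
  defines "n \<equiv> real K + 2 * N"
  shows "measure_pmf.expectation (draws K) (\<lambda>js. (norm (fw_dir P v (fw_state P orc x0 v js K)))\<^sup>2)
    \<le> 2 * (dstar - v)\<^sup>2 + (8 * H\<^sup>2 + G\<^sup>2 + 2 * (dstar - v)\<^sup>2) * (2 * N / n) ^ 3 + 4 * D\<^sup>2 / n"
proof -
  let ?V = "\<lambda>k. measure_pmf.expectation (draws K) (\<lambda>js. (norm (fw_dir P v (fw_state P orc x0 v js k)))\<^sup>2)"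
  have "?V k \<le> 2 * (dstar - v)\<^sup>2 + (8 * H\<^sup>2 + G\<^sup>2 + 2 * (dstar - v)\<^sup>2) * (2 * N / (k + 2 * blocks P)) ^ 3
      + 4 * D\<^sup>2 / (k + 2 * blocks P)" if "k \<le> K" for k :: nat
    using that
  proof (induction k)
    case 0
    have "?V 0 \<le> measure_pmf.expectation (draws K) (\<lambda>_. 8 * H\<^sup>2 + G\<^sup>2 + 2 * (dstar - v)\<^sup>2)"
      by (intro expectation_pmf_mono finite_draws fw_initial_le)
    then have "?V 0 \<le> 8 * H\<^sup>2 + G\<^sup>2 + 2 * (dstar - v)\<^sup>2" by simp
    moreover have "2 * N / real (0 + 2 * blocks P) = 1" using N_ge_1 by simp
    moreover have "0 \<le> 4 * D\<^sup>2 / real (0 + 2 * blocks P)" by simp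
    moreover have "0 \<le> (dstar - v)\<^sup>2" by simp
    ultimately show ?case by (simp only: power_one mult_1_right)
  next
    case (Suc k)
    have "?V (Suc k) \<le> (1 - 3 / (k + 2 * blocks P)) * ?V k
        + 4 / (k + 2 * blocks P) * (dstar - v)\<^sup>2 + 4 * D\<^sup>2 / (k + 2 * blocks P)\<^sup>2"
      using Suc.prems fw_expected_step [of k K v] by simp
    also have "\<dots> \<le> 2 * (dstar - v)\<^sup>2
        + (8 * H\<^sup>2 + G\<^sup>2 + 2 * (dstar - v)\<^sup>2) * (2 * N / Suc (k + 2 * blocks P)) ^ 3
        + 4 * D\<^sup>2 / Suc (k + 2 * blocks P)"
      using Suc N_ge_1 by (intro residual_recursion) (auto intro: integral_nonneg_AE)
    finally show ?case by simp
  qed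
  from this [of K] show ?thesis by (simp add: n_def)
qed

text \<open>The bound is linear in \<open>dstar - v\<close>, as stage 1 controls only the first
  moment of the gap.\<close>

lemma fw_expected_residual:
  assumes v: "v \<le> dstar" and \<epsilon>: "0 \<le> \<epsilon>" and K: "1 \<le> K"
    and K1: "36 * D\<^sup>2 \<le> \<epsilon>\<^sup>2 * real K"
    and K2: "9 * (8 * H\<^sup>2 + G\<^sup>2) * (2 * N / real K) ^ 3 \<le> \<epsilon>\<^sup>2"
  shows "measure_pmf.expectation (draws K) (\<lambda>js. norm (fw_dir P v (fw_state P orc x0 v js K)))
    \<le> 2 * (dstar - v) + \<epsilon> / 2"
proof -
  let ?n = "real K + 2 * N" and ?\<delta> = "dstar - v"
  let ?E = "\<lambda>f :: (nat \<Rightarrow> nat) \<Rightarrow> real. measure_pmf.expectation (draws K) f"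
  have n: "real K \<le> ?n" "0 < ?n" "2 * N \<le> ?n" and Kpos: "0 < real K" using K N_ge_1 by auto
  have "(?E (\<lambda>js. norm (fw_dir P v (fw_state P orc x0 v js K))))\<^sup>2
      \<le> ?E (\<lambda>js. (norm (fw_dir P v (fw_state P orc x0 v js K)))\<^sup>2)"
    by (intro expectation_pmf_power2_le finite_draws)
  also have "\<dots> \<le> 2 * ?\<delta>\<^sup>2 + (8 * H\<^sup>2 + G\<^sup>2 + 2 * ?\<delta>\<^sup>2) * (2 * N / ?n) ^ 3 + 4 * D\<^sup>2 / ?n"
    by (rule fw_expected_residual_power2)
  \<comment> \<open>Each of the two growth conditions on \<open>K\<close> pays for one
    \<open>\<epsilon>\<^sup>2 / 9\<close>; the gap terms add up to at most four squared
    gaps.\<close>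
  also have "\<dots> \<le> 4 * ?\<delta>\<^sup>2 + \<epsilon>\<^sup>2 / 9 + \<epsilon>\<^sup>2 / 9"
  proof -
    have "(2 * N / ?n) ^ 3 \<le> 1"
      using n N_ge_1 by (intro power_le_one) auto
    then have "2 * ?\<delta>\<^sup>2 * (2 * N / ?n) ^ 3 \<le> 2 * ?\<delta>\<^sup>2"
      by (intro mult_right_le_one_le) (use n N_ge_1 in auto)
    moreover define X where "X = 8 * H\<^sup>2 + G\<^sup>2"
    moreover have "X * (2 * N / ?n) ^ 3 \<le> X * (2 * N / real K) ^ 3"
      using n Kpos N_ge_1 by (intro mult_left_mono power_mono divide_left_mono) (auto simp: X_def)
    moreover have "4 * D\<^sup>2 / ?n \<le> \<epsilon>\<^sup>2 / 9"
    proof -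
      have "4 * D\<^sup>2 / ?n \<le> 4 * D\<^sup>2 / real K" using n Kpos by (intro divide_left_mono) auto
      also have "\<dots> \<le> \<epsilon>\<^sup>2 / 9" using K1 Kpos by (simp add: field_simps)
      finally show ?thesis .
    qed
    ultimately show ?thesis using K2 [folded X_def] by (simp add: distrib_right)
  qed
  \<comment> \<open>Uses \<open>2 / 9 \<le> 1 / 4\<close> and the nonnegative cross term of the
    square.\<close>
  also have "\<dots> \<le> (2 * ?\<delta> + \<epsilon> / 2)\<^sup>2"
  proof -
    have "(2 * d + \<epsilon> / 2)\<^sup>2 = 4 * d\<^sup>2 + 2 * (d * \<epsilon>) + \<epsilon>\<^sup>2 / 4" for d
      by (simp add: power2_eq_square field_simps)
    from this [of ?\<delta>] show ?thesis
      using mult_nonneg_nonneg [of ?\<delta> \<epsilon>] zero_le_power2 [of \<epsilon>] v \<epsilon> by linarith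
  qed
  finally show ?thesis
    by (rule power2_le_imp_le) (use v \<epsilon> in simp)
qed

section \<open>Recovery of a primal point\<close>

lemma obj_eq: "i \<in> idx P \<Longrightarrow> x \<in> domf P i \<Longrightarrow> obj P i x = ereal (fval P i x)"
  using problem
  by (cases "obj P i x") (auto simp: separable_problem_def proper_fun_def domf_def edom_def fval_def)

definition max_nonconvexity :: ereal where
  "max_nonconvexity = Max ((\<lambda>i. nonconvexity (dims P i) (obj P i)) ` idx P)"

lemma nonconvexity_le_max: "i \<in> idx P \<Longrightarrow> nonconvexity (dims P i) (obj P i) \<le> max_nonconvexity"
  unfolding max_nonconvexity_def by (intro Max_ge) auto

text \<open>A one-point combination has gap zero. Nonnegativity allows \<open>card S\<close> to be
  replaced by \<open>m + 1\<close> and excludes the value \<open>- \<infinity>\<close>.\<close>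

lemma max_nonconvexity_nonneg: "0 \<le> max_nonconvexity"
proof -
  obtain i where i: "i \<in> idx P" using idx_nonempty by blast
  have "x0 i \<in> domf P i" using start [OF i] by blast
  then have "0 \<le> nonconvexity (dims P i) (obj P i)"
    using jensen_gap_le_nonconvexity [of "{0}" "\<lambda>_. x0 i" "dims P i" "obj P i" "\<lambda>_. 1"] obj_eq [OF i]
    by (simp add: domf_def)
  also have "\<dots> \<le> max_nonconvexity" by (rule nonconvexity_le_max [OF i])
  finally show ?thesis .
qed

text \<open>Blocks outside \<open>S\<close> are reproduced exactly. A block of \<open>S\<close>
  loses at most its nonconvexity, and a convex domain keeps its average where the objective is
  finite. The constraint part is exact by linearity.\<close>

lemma
  assumes decomp: "caratheodory_decomp P Q x out S w sel"
    and convex: "\<forall>i\<in>idx P. convex (domf P i)"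
    and fin: "\<And>i. i \<in> idx P \<Longrightarrow> finite (Q i)"
    and x: "\<And>i l. i \<in> idx P \<Longrightarrow> l \<in> Q i \<Longrightarrow> x i l \<in> domf P i"
  shows recovered_objective_le: "max_nonconvexity = ereal r \<Longrightarrow>
      (1 / N) * (\<Sum>i\<in>idx P. fval P i (recovered Q x S w sel i)) \<le> fst out + (real m + 1) / N * r"
    and recovered_constraint: "(1 / N) *\<^sub>R (\<Sum>i\<in>idx P. Aop P i (recovered Q x S w sel i)) = snd out"
proof -
  let ?y = "recovered Q x S w sel"
  have S: "S \<subseteq> idx P" "card S \<le> m + 1"
    and w: "\<And>i l. i \<in> idx P \<Longrightarrow> l \<in> Q i \<Longrightarrow> 0 \<le> w i l" "\<And>i. i \<in> idx P \<Longrightarrow> (\<Sum>l\<in>Q i. w i l) = 1"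
    and out: "out = (\<Sum>i\<in>S. \<Sum>l\<in>Q i. (w i l / N) *\<^sub>R (fval P i (x i l), Aop P i (x i l))) +
       (\<Sum>i\<in>idx P - S. (1 / N) *\<^sub>R (fval P i (x i (sel i)), Aop P i (x i (sel i))))"
    using decomp by (auto simp: caratheodory_decomp_def)
  have split: "sum g (idx P) = sum g S + sum g (idx P - S)" for g :: "nat \<Rightarrow> 'c::comm_monoid_add"
    using sum.subset_diff [OF S(1), of g] by (simp add: add.commute)
  show "(1 / N) *\<^sub>R (\<Sum>i\<in>idx P. Aop P i (?y i)) = snd out"
    unfolding split out
    by (simp add: snd_sum recovered_def linear_sum [OF linear_Aop] linear_cmul [OF linear_Aop]
        scaleR_add_right scaleR_sum_right)
  show "(1 / N) * (\<Sum>i\<in>idx P. fval P i (?y i)) \<le> fst out + (real m + 1) / N * r"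
    if r: "max_nonconvexity = ereal r"
  proof -
    have gap: "fval P i (?y i) \<le> (\<Sum>l\<in>Q i. w i l * fval P i (x i l)) + r" if i: "i \<in> S" for i
    proof -
      have i': "i \<in> idx P" using i S by blast
      have "obj P i (?y i) = ereal (fval P i (?y i))"
        using decomp i' fin convex x by (intro obj_eq recovered_in_domf) auto
      moreover have "obj P i (?y i) - (\<Sum>l\<in>Q i. ereal (w i l) * obj P i (x i l)) \<le> ereal r"
        using jensen_gap_le_nonconvexity [of "Q i" "x i" "dims P i" "obj P i" "w i"]
          nonconvexity_le_max [OF i'] fin x w i i' order_trans
        unfolding r recovered_def domf_def by fastforce
      moreover have "(\<Sum>l\<in>Q i. ereal (w i l) * obj P i (x i l)) = ereal (\<Sum>l\<in>Q i. w i l * fval P i (x i l))"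
        unfolding sum_ereal [symmetric] using i' x by (intro sum.cong) (auto simp: obj_eq)
      ultimately show ?thesis by simp
    qed
    have "(\<Sum>i\<in>S. fval P i (?y i)) \<le> (\<Sum>i\<in>S. (\<Sum>l\<in>Q i. w i l * fval P i (x i l)) + r)"
      by (intro sum_mono gap)
    also have "\<dots> \<le> (\<Sum>i\<in>S. \<Sum>l\<in>Q i. w i l * fval P i (x i l)) + (real m + 1) * r"
      using S(2) max_nonconvexity_nonneg r by (auto simp: sum.distrib intro!: mult_right_mono)
    finally have "(\<Sum>i\<in>idx P. fval P i (?y i)) \<le> (\<Sum>i\<in>S. \<Sum>l\<in>Q i. w i l * fval P i (x i l))
        + (\<Sum>i\<in>idx P - S. fval P i (x i (sel i))) + (real m + 1) * r"
      unfolding split by (simp add: recovered_def)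
    then have "(1 / N) * (\<Sum>i\<in>idx P. fval P i (?y i)) \<le> (1 / N) * ((\<Sum>i\<in>S. \<Sum>l\<in>Q i. w i l * fval P i (x i l))
        + (\<Sum>i\<in>idx P - S. fval P i (x i (sel i))) + (real m + 1) * r)"
      using N_ge_1 by (intro mult_left_mono) auto
    also have "\<dots> = fst out + (real m + 1) / N * r"
      unfolding out by (simp add: fst_sum sum_divide_distrib add_divide_distrib distrib_right)
    finally show ?thesis .
  qed
qed

text \<open>Holds on every sample path. Since \<open>v \<le> dstar\<close>, the excess over
  \<open>dstar\<close> is at most the excess over \<open>v\<close>, which the first component of the
  residual dominates; the second component is the constraint violation.\<close>

lemma two_stage_output_le:
  assumes out: "two_stage_output P orc \<alpha> 0 x0 T K xbar"
    and convex: "\<forall>i\<in>idx P. convex (domf P i)"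
    and \<omega>: "\<omega> \<in> set_pmf (samples P T K)"
  defines "res \<equiv> norm (fw_dir P (run_v P orc \<alpha> 0 T \<omega>) (fw_state P orc x0 (run_v P orc \<alpha> 0 T \<omega>) (snd \<omega>) K))"
  shows "max_nonconvexity = ereal r \<Longrightarrow>
      (1 / N) * (\<Sum>i\<in>idx P. fval P i (xbar \<omega> i)) - dstar \<le> res + (real m + 1) / N * r" (is "_ \<Longrightarrow> ?obj")
    and "norm_plus m ((1 / N) *\<^sub>R (\<Sum>i\<in>idx P. Aop P i (xbar \<omega> i)) - b) \<le> res" (is ?con)
proof -
  define v where "v = run_v P orc \<alpha> 0 T \<omega>"
  define s where "s = fw_state P orc x0 v (snd \<omega>) K"
  obtain S w sel where decomp: "caratheodory_decomp P (Qset K (snd \<omega>)) (run_point P orc \<alpha> 0 x0 T \<omega>)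
        (run_out P orc \<alpha> 0 x0 T K \<omega>) S w sel"
    and xbar: "xbar \<omega> = recovered (Qset K (snd \<omega>)) (run_point P orc \<alpha> 0 x0 T \<omega>) S w sel"
    using out \<omega> unfolding two_stage_output_def by blast
  have fin: "finite (Qset K (snd \<omega>) i)" if "i \<in> idx P" for i
    unfolding Qset_def by simp
  have point: "run_point P orc \<alpha> 0 x0 T \<omega> i l \<in> domf P i"
    if "i \<in> idx P" "l \<in> Qset K (snd \<omega>) i" for i l
    using start [OF that(1)] fw_oracle(2) [OF valid_fw_state that(1)]
    by (auto simp: run_point_def fw_point_def split: nat.split)
  have run_out: "run_out P orc \<alpha> 0 x0 T K \<omega> = (\<Sum>i\<in>idx P. s i)"
    by (simp add: run_out_def s_def v_def)
  have s_Rn: "(\<Sum>i\<in>idx P. snd (s i)) - b \<in> Rn m"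
    using valid_Rn [OF valid_fw_state] b_Rn unfolding s_def by (intro Rn_diff Rn_sum)
  have res: "res = norm (fw_dir P v s)"
    by (simp add: res_def s_def v_def)
  have "v \<le> dstar"
    unfolding v_def run_v_def by (intro dval_le_dstar sg_avg_orthant)
  moreover have "(\<Sum>i\<in>idx P. fst (s i)) - v \<le> res"
    using norm_fst_le [of "fst (fw_dir P v s)" "snd (fw_dir P v s)"] unfolding res
    by (simp add: fw_dir_def)
  ultimately show "max_nonconvexity = ereal r \<Longrightarrow> ?obj"
    using recovered_objective_le [OF decomp convex fin point]
    unfolding xbar run_out by (fastforce simp: fst_sum)
  have "(1 / N) *\<^sub>R (\<Sum>i\<in>idx P. Aop P i (xbar \<omega> i)) = (\<Sum>i\<in>idx P. snd (s i))"
    using recovered_constraint [OF decomp convex fin point]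
    by (simp only: xbar run_out snd_sum)
  then have "norm_plus m ((1 / N) *\<^sub>R (\<Sum>i\<in>idx P. Aop P i (xbar \<omega> i)) - b) = norm (snd (fw_dir P v s))"
    by (simp only: norm_plus_eq_norm_proj_plus [OF s_Rn] fw_dir_def snd_conv)
  then show ?con
    unfolding res using norm_snd_le [of "snd (fw_dir P v s)" "fst (fw_dir P v s)"] by simp
qed

section \<open>Averaging over all randomness\<close>

lemma finite_samples: "finite (set_pmf (samples P T K))"
  unfolding samples_def using finite_draws by simp

text \<open>Stage 2 is averaged first, with the draws of stage 1 fixed. The expected dual gap then
  gives \<open>2 * (\<epsilon> / 4) + \<epsilon> / 2\<close>.\<close>

lemma expected_residual_le:
  fixes T :: nat
  assumes \<Lambda>: "0 < \<Lambda>" and \<epsilon>: "0 \<le> \<epsilon>" and T: "1 \<le> T"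
    and T1: "36 * D\<^sup>2 \<le> \<epsilon>\<^sup>2 * real T"
    and T2: "9 * (8 * H\<^sup>2 + G\<^sup>2) * (2 * N / real T) ^ 3 \<le> \<epsilon>\<^sup>2"
    and T3: "G * ((norm lamstar)\<^sup>2 + \<Lambda>\<^sup>2) / (2 * \<Lambda> * sqrt (real T)) \<le> \<epsilon> / 4"
  defines "v \<equiv> run_v P orc (\<lambda>t. \<Lambda> / (G * sqrt (real T))) 0 T"
  shows "measure_pmf.expectation (samples P T T)
    (\<lambda>\<omega>. norm (fw_dir P (v \<omega>) (fw_state P orc x0 (v \<omega>) (snd \<omega>) T))) \<le> \<epsilon>"
proof -
  let ?d = "\<lambda>is. dval P (sg_avg P orc (\<lambda>t. \<Lambda> / (G * sqrt (real T))) 0 T is)"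
  have "measure_pmf.expectation (samples P T T)
      (\<lambda>\<omega>. norm (fw_dir P (v \<omega>) (fw_state P orc x0 (v \<omega>) (snd \<omega>) T)))
    = measure_pmf.expectation (draws (T - 1)) (\<lambda>is. measure_pmf.expectation (draws T)
        (\<lambda>js. norm (fw_dir P (?d is) (fw_state P orc x0 (?d is) js T))))"
    unfolding samples_def v_def run_v_def
    by (subst expectation_pair_pmf) (simp_all add: finite_draws)
  also have "\<dots> \<le> measure_pmf.expectation (draws (T - 1)) (\<lambda>is. 2 * (dstar - ?d is) + \<epsilon> / 2)"
    using \<epsilon> T T1 T2
    by (intro expectation_pmf_mono finite_draws fw_expected_residual dval_le_dstar sg_avg_orthant)
  also have "\<dots> = 2 * measure_pmf.expectation (draws (T - 1)) (\<lambda>is. dstar - ?d is) + \<epsilon> / 2"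
    by simp
  also have "\<dots> \<le> \<epsilon>"
    using expected_dual_gap_le [OF T \<Lambda>] T3 by linarith
  finally show ?thesis .
qed

lemma two_stage_guarantee:
  fixes T :: nat
  assumes \<Lambda>: "0 < \<Lambda>" and \<epsilon>: "0 \<le> \<epsilon>" and T: "1 \<le> T"
    and T1: "36 * D\<^sup>2 \<le> \<epsilon>\<^sup>2 * real T"
    and T2: "9 * (8 * H\<^sup>2 + G\<^sup>2) * (2 * N / real T) ^ 3 \<le> \<epsilon>\<^sup>2"
    and T3: "G * ((norm lamstar)\<^sup>2 + \<Lambda>\<^sup>2) / (2 * \<Lambda> * sqrt (real T)) \<le> \<epsilon> / 4"
    and convex: "\<forall>i\<in>idx P. convex (domf P i)"
    and out: "two_stage_output P orc (\<lambda>t. \<Lambda> / (G * sqrt (real T))) 0 x0 T T xbar"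
  shows "ereal (measure_pmf.expectation (samples P T T)
        (\<lambda>\<omega>. (1 / N) * (\<Sum>i\<in>idx P. fval P i (xbar \<omega> i)) - dstar))
      \<le> ereal ((real m + 1) / N) * max_nonconvexity + ereal \<epsilon>" (is "ereal ?obj \<le> _")
    and "measure_pmf.expectation (samples P T T)
        (\<lambda>\<omega>. norm_plus m ((1 / N) *\<^sub>R (\<Sum>i\<in>idx P. Aop P i (xbar \<omega> i)) - b)) \<le> \<epsilon>" (is "?con \<le> _")
proof -
  define v where "v = run_v P orc (\<lambda>t. \<Lambda> / (G * sqrt (real T))) 0 T"
  define res where "res \<omega> = norm (fw_dir P (v \<omega>) (fw_state P orc x0 (v \<omega>) (snd \<omega>) T))" for \<omega>
  have E: "measure_pmf.expectation (samples P T T) res \<le> \<epsilon>"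
    unfolding res_def v_def by (rule expected_residual_le [OF \<Lambda> \<epsilon> T T1 T2 T3])
  have "?con \<le> measure_pmf.expectation (samples P T T) res"
    unfolding res_def v_def
    by (intro expectation_pmf_mono finite_samples two_stage_output_le [OF out convex])
  with E show "?con \<le> \<epsilon>" by simp
  show "ereal ?obj \<le> ereal ((real m + 1) / N) * max_nonconvexity + ereal \<epsilon>"
  \<comment> \<open>The maximum is an extended real: \<open>\<infinity>\<close> makes the bound
    trivial, \<open>- \<infinity>\<close> contradicts nonnegativity.\<close>
  proof (cases max_nonconvexity)
    case (real r)
    have "?obj \<le> measure_pmf.expectation (samples P T T) (\<lambda>\<omega>. res \<omega> + (real m + 1) / N * r)"
      unfolding res_def v_def
      by (intro expectation_pmf_mono finite_samples two_stage_output_le [OF out convex] real)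
    also have "\<dots> = measure_pmf.expectation (samples P T T) res + (real m + 1) / N * r"
      by (simp add: integrable_measure_pmf_finite finite_samples)
    finally show ?thesis using E real by simp
  next
    case PInf
    then show ?thesis using N_ge_1 by simp
  next
    case MInf
    then show ?thesis using max_nonconvexity_nonneg by simp
  qed
qed

end

text \<open>\<open>C\<close> is chosen before \<open>P\<close> and \<open>\<epsilon>\<close>, so the
  hidden constant depends only on its five arguments. The cost bound is stated for
  \<open>\<epsilon> \<le> 1\<close>: the full step alone makes \<open>N\<close> calls, while both
  rates vanish as \<open>\<epsilon>\<close> grows.\<close>

theorem corollary4p1:
  shows "\<exists>C :: real \<Rightarrow> real \<Rightarrow> real \<Rightarrow> real \<Rightarrow> real \<Rightarrow> real.
    \<forall>(P :: separable) (lamstar :: fvec) (\<Lambda> :: real) (\<epsilon> :: real).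
      separable_problem P \<longrightarrow> (\<forall>i\<in>idx P. convex (domf P i)) \<longrightarrow> Hsup P < \<infinity> \<longrightarrow>
      strong_duality P lamstar \<longrightarrow> 0 < \<Lambda> \<longrightarrow> 0 < \<epsilon> \<longrightarrow>
      (\<exists>T K :: nat. 1 \<le> T \<and> T = K \<and>
        (\<epsilon> \<le> 1 \<longrightarrow> real (oracle_calls P T K)
           \<le> C (Gtilde P) (real_of_ereal (Hsup P)) (Dconst P) \<Lambda> (norm lamstar)
               * (1 / \<epsilon>\<^sup>2 + real (blocks P) / \<epsilon> powr (2 / 3))) \<and>
        (\<forall>orc x0 xbar.
           is_oracle P orc \<longrightarrow>
           (\<forall>i\<in>idx P. x0 i \<in> domf P i \<and> obj P i (x0 i) = fbb P i (x0 i)) \<longrightarrow>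
           two_stage_output P orc (\<lambda>t. \<Lambda> / (Gtilde P * sqrt (real T))) 0 x0 T K xbar \<longrightarrow>
           ereal (measure_pmf.expectation (samples P T K)
                    (\<lambda>\<omega>. (1 / real (blocks P)) * (\<Sum>i\<in>idx P. fval P i (xbar \<omega> i))
                          - dval P lamstar))
             \<le> ereal ((real (ncons P) + 1) / real (blocks P))
                 * Max ((\<lambda>i. nonconvexity (dims P i) (obj P i)) ` idx P) + ereal \<epsilon> \<and>
           measure_pmf.expectation (samples P T K)
             (\<lambda>\<omega>. norm_plus (ncons P)
                     ((1 / real (blocks P)) *\<^sub>R (\<Sum>i\<in>idx P. Aop P i (xbar \<omega> i)) - rhs P))
             \<le> \<epsilon>))"
proof -
  define c1 where "c1 G D \<Lambda> L = 36 * D\<^sup>2 + (2 * G * (L\<^sup>2 + \<Lambda>\<^sup>2) / \<Lambda>)\<^sup>2" for G D \<Lambda> L :: real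
  define c2 where "c2 G H = 2 * (9 * (8 * H\<^sup>2 + G\<^sup>2) + 1)" for G H :: real
  show ?thesis
  proof (rule exI [of _ "\<lambda>G H D \<Lambda> L. 2 * c1 G D \<Lambda> L + 2 * c2 G H + 3"], intro allI impI)
    fix P lamstar and \<Lambda> \<epsilon> :: real
    assume P: "separable_problem P" "\<forall>i\<in>idx P. convex (domf P i)" "Hsup P < \<infinity>"
      "strong_duality P lamstar" and \<Lambda>: "0 < \<Lambda>" and \<epsilon>: "0 < \<epsilon>"
    let ?G = "Gtilde P" and ?H = "real_of_ereal (Hsup P)" and ?D = "Dconst P" and ?L = "norm lamstar"
    have N: "1 \<le> blocks P" using P by (simp add: separable_problem_def)
    \<comment> \<open>\<open>T\<close> is fixed before the oracle, the start and the decomposition,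
      so one choice serves them all.\<close>
    define T where
      "T = nat \<lceil>c1 ?G ?D \<Lambda> ?L / \<epsilon>\<^sup>2 + c2 ?G ?H * (blocks P / \<epsilon> powr (2 / 3))\<rceil> + 1"
    note count = iteration_count [OF \<Lambda> \<epsilon> N, where G = ?G and H = ?H and D = ?D and L = ?L,
        folded c1_def c2_def, folded T_def]
    show "\<exists>T K :: nat. 1 \<le> T \<and> T = K \<and>
        (\<epsilon> \<le> 1 \<longrightarrow> real (oracle_calls P T K)
           \<le> (2 * c1 ?G ?D \<Lambda> ?L + 2 * c2 ?G ?H + 3) * (1 / \<epsilon>\<^sup>2 + real (blocks P) / \<epsilon> powr (2 / 3))) \<and>
        (\<forall>orc x0 xbar.
           is_oracle P orc \<longrightarrow>
           (\<forall>i\<in>idx P. x0 i \<in> domf P i \<and> obj P i (x0 i) = fbb P i (x0 i)) \<longrightarrow>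
           two_stage_output P orc (\<lambda>t. \<Lambda> / (Gtilde P * sqrt (real T))) 0 x0 T K xbar \<longrightarrow>
           ereal (measure_pmf.expectation (samples P T K)
                    (\<lambda>\<omega>. (1 / real (blocks P)) * (\<Sum>i\<in>idx P. fval P i (xbar \<omega> i))
                          - dval P lamstar))
             \<le> ereal ((real (ncons P) + 1) / real (blocks P))
                 * Max ((\<lambda>i. nonconvexity (dims P i) (obj P i)) ` idx P) + ereal \<epsilon> \<and>
           measure_pmf.expectation (samples P T K)
             (\<lambda>\<omega>. norm_plus (ncons P)
                     ((1 / real (blocks P)) *\<^sub>R (\<Sum>i\<in>idx P. Aop P i (xbar \<omega> i)) - rhs P))
             \<le> \<epsilon>)"
    proof (rule exI [of _ T], rule exI [of _ T], intro conjI allI impI)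
      show T: "1 \<le> T" by (simp add: T_def)
      show "real (oracle_calls P T T)
          \<le> (2 * c1 ?G ?D \<Lambda> ?L + 2 * c2 ?G ?H + 3) * (1 / \<epsilon>\<^sup>2 + real (blocks P) / \<epsilon> powr (2 / 3))"
        if "\<epsilon> \<le> 1"
        using count(4) [OF that] by (simp add: oracle_calls_def)
      fix orc x0 xbar
      assume o: "is_oracle P orc" "\<forall>i\<in>idx P. x0 i \<in> domf P i \<and> obj P i (x0 i) = fbb P i (x0 i)"
        "two_stage_output P orc (\<lambda>t. \<Lambda> / (Gtilde P * sqrt (real T))) 0 x0 T T xbar"
      interpret two_stage P lamstar orc x0
        using P o by unfold_locales auto
      note guarantee = two_stage_guarantee [OF \<Lambda> less_imp_le [OF \<epsilon>] T count(1-3) P(2) o(3)]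
      show "ereal (measure_pmf.expectation (samples P T T)
              (\<lambda>\<omega>. (1 / real (blocks P)) * (\<Sum>i\<in>idx P. fval P i (xbar \<omega> i)) - dval P lamstar))
          \<le> ereal ((real (ncons P) + 1) / real (blocks P))
              * Max ((\<lambda>i. nonconvexity (dims P i) (obj P i)) ` idx P) + ereal \<epsilon>"
        using guarantee(1) unfolding max_nonconvexity_def .
      show "measure_pmf.expectation (samples P T T)
             (\<lambda>\<omega>. norm_plus (ncons P)
                     ((1 / real (blocks P)) *\<^sub>R (\<Sum>i\<in>idx P. Aop P i (xbar \<omega> i)) - rhs P)) \<le> \<epsilon>"
        by (rule guarantee(2))
    qed simp
  qed
qed

end
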